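(* Let $\mathcal{H}=l^2(\mathbb{Z}^2)$ and $H=A+V_1+V_2$, where $A$ is an operator on $\mathcal{H}$ of the form $(A\phi)(x)=\sum_{r=1}^m a_r(x)\phi(x+b_r)$, with $m\in\mathbb{Z}_+$, $b_r\in\mathbb{Z}^2$ and $a_r\in l^\infty(\mathbb{Z}^2)$, which is periodic in both the horizontal and vertical directions, and $V_1,V_2$ are (multiplication operators by) bounded potentials on $\mathbb{Z}^2$ such that, for some finite $a_1,a_2$, $V_1$ has support in $\mathbb{Z}\times[-a_2,a_2]$ and $V_2$ has support in $[-a_1,a_1]\times\mathbb{Z}$. Let $\mathcal{J}_1,\mathcal{J}_2$, $\mathcal{A}$, $\sigma_1,\sigma_2$ be as defined in the context. Then $H\in\mathcal{A}$ and $$\sigma_{\rm ess}(H)=\sigma_1(A+V_1)\cup\sigma_2(A+V_2).$$ If $V_1$ is periodic in the $x_1$ direction and $V_2$ is periodic in the $x_2$ direction then $$\sigma_{\rm ess}(H)=\sigma(A+V_1)\cup\sigma(A+V_2).$$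
   Context: For $n\ge1$ define projections on $l^2(\mathbb{Z}^2)$ by $(p_n\phi)(i,j)=\phi(i,j)$ if $-n\le i\le n$ and $0$ otherwise, and $(q_n\phi)(i,j)=\phi(i,j)$ if $-n\le j\le n$ and $0$ otherwise. $\mathcal{J}_1$ is the norm closure in $\mathcal{L}(\mathcal{H})$ of $\{x\in\mathcal{L}(\mathcal{H}):\exists n\ge1,\ p_nx=xp_n=x\}$, and $\mathcal{J}_2$ is the norm closure of $\{x\in\mathcal{L}(\mathcal{H}):\exists n\ge1,\ q_nx=xq_n=x\}$. Let $\mathcal{A}=\{x\in\mathcal{L}(\mathcal{H}): x\mathcal{J}_1\subseteq\mathcal{J}_1,\ \mathcal{J}_1x\subseteq\mathcal{J}_1,\ x\mathcal{J}_2\subseteq\mathcal{J}_2,\ \mathcal{J}_2x\subseteq\mathcal{J}_2\}$, a $C^*$-algebra with identity in which $\mathcal{J}_1,\mathcal{J}_2$ are closed two-sided ideals. For $x\in\mathcal{A}$ and $r=1,2$, $\sigma_r(x)$ is the spectrum of the image of $x$ in $\mathcal{A}/\mathcal{J}_r$. $\sigma_{\rm ess}(x)$ is the spectrum of the image of $x$ in the Calkin algebra $\mathcal{L}(\mathcal{H})/\mathcal{K}(\mathcal{H})$. An operator (or the multiplication operator by a potential) is periodic in a coordinate direction if for some integer $k\ge1$ it commutes with translation by $k$ in that direction. *)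

theory Defs
  imports "HOL-Analysis.Analysis" "HOL-Algebra.QuotRing"
begin

typedef 'a ell2 = "{f :: 'a \<Rightarrow> complex. (\<lambda>x. (cmod (f x))\<^sup>2) summable_on UNIV}"
  morphisms coord Ell2
  by (rule exI[of _ "\<lambda>_. 0"]) simp

setup_lifting type_definition_ell2

lemma sq_summable_comparison:
  fixes f g :: "'a \<Rightarrow> complex"
  assumes "(\<lambda>x. (cmod (f x))\<^sup>2) summable_on UNIV" "\<And>x. cmod (g x) \<le> c * cmod (f x)"
  shows "(\<lambda>x. (cmod (g x))\<^sup>2) summable_on UNIV"
proof (rule summable_on_comparison_test)
  show "(\<lambda>x. c\<^sup>2 * (cmod (f x))\<^sup>2) summable_on UNIV"
    using assms(1) by (rule summable_on_cmult_right)
  show "(cmod (g x))\<^sup>2 \<le> c\<^sup>2 * (cmod (f x))\<^sup>2" for x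
    using power_mono[OF assms(2)[of x], of 2] by (simp add: power_mult_distrib)
qed simp

lemma sq_summable_add:
  fixes f g :: "'a \<Rightarrow> complex"
  assumes "(\<lambda>x. (cmod (f x))\<^sup>2) summable_on UNIV" "(\<lambda>x. (cmod (g x))\<^sup>2) summable_on UNIV"
  shows "(\<lambda>x. (cmod (f x + g x))\<^sup>2) summable_on UNIV"
proof (rule summable_on_comparison_test)
  show "(\<lambda>x. 2 * (cmod (f x))\<^sup>2 + 2 * (cmod (g x))\<^sup>2) summable_on UNIV"
    using assms by (intro summable_on_add summable_on_cmult_right)
  show "(cmod (f x + g x))\<^sup>2 \<le> 2 * (cmod (f x))\<^sup>2 + 2 * (cmod (g x))\<^sup>2" for x
  proof -
    have "(cmod (f x + g x))\<^sup>2 \<le> (cmod (f x) + cmod (g x))\<^sup>2"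
      by (intro power_mono norm_triangle_ineq norm_ge_zero)
    also have "\<dots> \<le> 2 * (cmod (f x))\<^sup>2 + 2 * (cmod (g x))\<^sup>2"
      using zero_le_power2[of "cmod (f x) - cmod (g x)"]
      by (simp add: power2_eq_square algebra_simps)
    finally show ?thesis .
  qed
qed simp

lemma inner_summable:
  fixes f g :: "'a \<Rightarrow> complex"
  assumes "(\<lambda>x. (cmod (f x))\<^sup>2) summable_on UNIV" "(\<lambda>x. (cmod (g x))\<^sup>2) summable_on UNIV"
  shows "(\<lambda>x. inner (f x) (g x)) summable_on UNIV"
proof (rule abs_summable_summable, rule summable_on_comparison_test)
  show "(\<lambda>x. (cmod (f x))\<^sup>2 + (cmod (g x))\<^sup>2) summable_on UNIV"
    using assms by (intro summable_on_add)
  show "norm (inner (f x) (g x)) \<le> (cmod (f x))\<^sup>2 + (cmod (g x))\<^sup>2" for x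
  proof -
    have "norm (inner (f x) (g x)) \<le> cmod (f x) * cmod (g x)"
      using Cauchy_Schwarz_ineq2 by simp
    also have "\<dots> \<le> (cmod (f x))\<^sup>2 + (cmod (g x))\<^sup>2"
      using zero_le_power2[of "cmod (f x) - cmod (g x)"]
        mult_nonneg_nonneg[OF norm_ge_zero norm_ge_zero, of "f x" "g x"]
      unfolding power2_diff by linarith
    finally show ?thesis .
  qed
qed simp

instantiation ell2 :: (type) real_vector
begin

lift_definition zero_ell2 :: "'a ell2" is "\<lambda>_. 0" by simp

lift_definition plus_ell2 :: "'a ell2 \<Rightarrow> 'a ell2 \<Rightarrow> 'a ell2" is "\<lambda>f g x. f x + g x"
  by (rule sq_summable_add)

lift_definition uminus_ell2 :: "'a ell2 \<Rightarrow> 'a ell2" is "\<lambda>f x. - f x" by simp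

lift_definition minus_ell2 :: "'a ell2 \<Rightarrow> 'a ell2 \<Rightarrow> 'a ell2" is "\<lambda>f g x. f x - g x"
  subgoal for f g using sq_summable_add[of f "\<lambda>x. - g x"] by simp
  done

lift_definition scaleR_ell2 :: "real \<Rightarrow> 'a ell2 \<Rightarrow> 'a ell2" is "\<lambda>r f x. r *\<^sub>R f x"
  subgoal for r f by (erule sq_summable_comparison[where c = "\<bar>r\<bar>"]) simp
  done

instance
  by standard (transfer; simp add: fun_eq_iff algebra_simps)+

end

lift_definition scaleC_ell2 :: "complex \<Rightarrow> 'a ell2 \<Rightarrow> 'a ell2" is "\<lambda>c f x. c * f x"
  subgoal for c f by (erule sq_summable_comparison[where c = "cmod c"]) (simp add: norm_mult)
  done

text \<open>
  The instance of the real class carries the real part of the complex inner product, since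
  \<open>inner z w = Re (z * cnj w)\<close> on the complex numbers. The norm is the usual one.
\<close>

instantiation ell2 :: (type) real_inner
begin

lift_definition inner_ell2 :: "'a ell2 \<Rightarrow> 'a ell2 \<Rightarrow> real"
  is "\<lambda>f g. \<Sum>\<^sub>\<infinity>x. inner (f x) (g x)" .

definition norm_ell2 :: "'a ell2 \<Rightarrow> real" where "norm_ell2 f = sqrt (inner f f)"
definition dist_ell2 :: "'a ell2 \<Rightarrow> 'a ell2 \<Rightarrow> real" where "dist_ell2 f g = norm (f - g)"
definition sgn_ell2 :: "'a ell2 \<Rightarrow> 'a ell2" where "sgn_ell2 f = f /\<^sub>R norm f"
definition uniformity_ell2 :: "('a ell2 \<times> 'a ell2) filter"
  where "uniformity_ell2 = (INF e\<in>{0<..}. principal {(x, y). dist x y < e})"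
definition open_ell2 :: "'a ell2 set \<Rightarrow> bool"
  where "open_ell2 U = (\<forall>x\<in>U. eventually (\<lambda>(x', y). x' = x \<longrightarrow> y \<in> U) uniformity)"

instance
proof
  fix f g h :: "'a ell2" and r :: real and U :: "'a ell2 set"
  show "inner f g = inner g f"
    by transfer (simp add: inner_commute)
  show "inner (f + g) h = inner f h + inner g h"
    by transfer (simp add: inner_add_left infsum_add inner_summable)
  show "inner (r *\<^sub>R f) g = r * inner f g"
    by transfer (simp add: infsum_cmult_right')
  show "0 \<le> inner f f"
    by transfer (simp add: infsum_nonneg)
  show "inner f f = 0 \<longleftrightarrow> f = 0"
  proof
    assume "inner f f = 0"
    then show "f = 0"
    proof transfer
      fix f :: "'a \<Rightarrow> complex"
      assume f: "(\<lambda>x. (cmod (f x))\<^sup>2) summable_on UNIV" and 0: "(\<Sum>\<^sub>\<infinity>x. inner (f x) (f x)) = 0"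
      have "inner (f x) (f x) = 0" for x
        by (rule nonneg_infsum_le_0D[where A = UNIV and f = "\<lambda>x. inner (f x) (f x)"])
          (use 0 inner_summable[OF f f] in auto)
      then show "f = (\<lambda>_. 0)" by (simp add: fun_eq_iff)
    qed
  next
    assume "f = 0"
    then show "inner f f = 0" by simp (transfer, simp)
  qed
  show "norm f = sqrt (inner f f)" by (rule norm_ell2_def)
  show "dist f g = norm (f - g)" by (rule dist_ell2_def)
  show "sgn f = f /\<^sub>R norm f" by (rule sgn_ell2_def)
  show "(uniformity :: ('a ell2 \<times> 'a ell2) filter)
      = (INF e\<in>{0<..}. principal {(x, y). dist x y < e})"
    by (rule uniformity_ell2_def)
  show "open U = (\<forall>x\<in>U. eventually (\<lambda>(x', y). x' = x \<longrightarrow> y \<in> U) uniformity)"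
    by (rule open_ell2_def)
qed

end

lemma norm_ell2: "norm f = sqrt (\<Sum>\<^sub>\<infinity>x. (cmod (coord f x))\<^sup>2)"
  by (simp add: norm_ell2_def inner_ell2.rep_eq dot_square_norm)

lemma coord_summable: "(\<lambda>x. (cmod (coord f x))\<^sup>2) summable_on UNIV"
  using coord by auto

lemma sum_coord_le_norm:
  assumes "finite F" shows "(\<Sum>x\<in>F. (cmod (coord f x))\<^sup>2) \<le> (norm f)\<^sup>2"
  using finite_sum_le_infsum[OF coord_summable assms, of f]
  by (simp add: norm_ell2 infsum_nonneg)

lemma norm_coord_le: "cmod (coord f x) \<le> norm f"
  using sum_coord_le_norm[of "{x}" f] by simp

lemma norm_ell2_le_mult:
  assumes "\<And>x. cmod (coord g x) \<le> c * cmod (coord f x)" "0 \<le> c"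
  shows "norm g \<le> c * norm f"
proof -
  have "(\<Sum>\<^sub>\<infinity>x. (cmod (coord g x))\<^sup>2) \<le> (\<Sum>\<^sub>\<infinity>x. c\<^sup>2 * (cmod (coord f x))\<^sup>2)"
    using power_mono[OF assms(1) norm_ge_zero, of _ 2]
    by (intro infsum_mono coord_summable summable_on_cmult_right)
      (simp add: power_mult_distrib)
  also have "\<dots> = c\<^sup>2 * (\<Sum>\<^sub>\<infinity>x. (cmod (coord f x))\<^sup>2)"
    by (rule infsum_cmult_right')
  finally show ?thesis
    using real_sqrt_le_mono assms(2) by (fastforce simp: norm_ell2 real_sqrt_mult)
qed

instance ell2 :: (type) banach
proof
  fix X :: "nat \<Rightarrow> 'a ell2"
  assume X: "Cauchy X"
  have "Cauchy (\<lambda>n. coord (X n) x)" for x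
  proof (rule CauchyI)
    fix e :: real assume "0 < e"
    then obtain M where M: "\<forall>m\<ge>M. \<forall>n\<ge>M. norm (X m - X n) < e"
      using CauchyD[OF X] by blast
    have "norm (coord (X m) x - coord (X n) x) < e" if "m \<ge> M" "n \<ge> M" for m n
      using M that norm_coord_le[of "X m - X n" x] by (fastforce simp: minus_ell2.rep_eq)
    then show "\<exists>M. \<forall>m\<ge>M. \<forall>n\<ge>M. norm (coord (X m) x - coord (X n) x) < e" by blast
  qed
  then have "\<forall>x. \<exists>l. (\<lambda>n. coord (X n) x) \<longlonglongrightarrow> l"
    by (simp add: Cauchy_convergent_iff convergent_def)
  then obtain f where f: "\<And>x. (\<lambda>n. coord (X n) x) \<longlonglongrightarrow> f x" by metis
  have bound: "(\<Sum>x\<in>F. (cmod (coord (X m) x - f x))\<^sup>2) \<le> e\<^sup>2"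
    if M: "\<forall>m\<ge>M. \<forall>n\<ge>M. norm (X m - X n) < e" and "m \<ge> M" "finite F" for e M m F
  proof (rule Lim_bounded)
    show "(\<lambda>n. \<Sum>x\<in>F. (cmod (coord (X m) x - coord (X n) x))\<^sup>2)
        \<longlonglongrightarrow> (\<Sum>x\<in>F. (cmod (coord (X m) x - f x))\<^sup>2)"
      by (intro tendsto_intros f)
    show "\<forall>n\<ge>M. (\<Sum>x\<in>F. (cmod (coord (X m) x - coord (X n) x))\<^sup>2) \<le> e\<^sup>2"
    proof (intro allI impI)
      fix n assume "n \<ge> M"
      have "(\<Sum>x\<in>F. (cmod (coord (X m) x - coord (X n) x))\<^sup>2) \<le> (norm (X m - X n))\<^sup>2"
        using sum_coord_le_norm[OF \<open>finite F\<close>, of "X m - X n"] by (simp add: minus_ell2.rep_eq)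
      also have "\<dots> \<le> e\<^sup>2"
        using M \<open>n \<ge> M\<close> \<open>m \<ge> M\<close> by (intro power_mono) (auto simp: less_imp_le)
      finally show "(\<Sum>x\<in>F. (cmod (coord (X m) x - coord (X n) x))\<^sup>2) \<le> e\<^sup>2" .
    qed
  qed
  have summ: "(\<lambda>x. (cmod (coord (X m) x - f x))\<^sup>2) summable_on UNIV"
    if "\<forall>m\<ge>M. \<forall>n\<ge>M. norm (X m - X n) < e" "m \<ge> M" for e M m
    by (rule nonneg_bdd_above_summable_on)
      (use bound[OF that] in \<open>auto intro!: bdd_aboveI2\<close>)
  obtain M where "\<forall>m\<ge>M. \<forall>n\<ge>M. norm (X m - X n) < 1"
    using CauchyD[OF X, of 1] by auto
  from sq_summable_add[OF coord_summable[of "X M"], of "\<lambda>x. f x - coord (X M) x"]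
    summ[OF this order_refl]
  have "(\<lambda>x. (cmod (f x))\<^sup>2) summable_on UNIV" by (simp add: norm_minus_commute)
  then have cf: "coord (Ell2 f) = f" by (simp add: Ell2_inverse)
  have "X \<longlonglongrightarrow> Ell2 f"
  proof (rule LIMSEQ_I)
    fix e :: real assume e: "0 < e"
    then obtain M where M: "\<forall>m\<ge>M. \<forall>n\<ge>M. norm (X m - X n) < e / 2"
      using CauchyD[OF X, of "e / 2"] by auto
    have "norm (X m - Ell2 f) < e" if "m \<ge> M" for m
    proof -
      have "(\<Sum>\<^sub>\<infinity>x. (cmod (coord (X m) x - f x))\<^sup>2) \<le> (e / 2)\<^sup>2"
        using summ[OF M that] bound[OF M that] by (intro infsum_le_finite_sums) auto
      then have "norm (X m - Ell2 f) \<le> sqrt ((e / 2)\<^sup>2)"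
        unfolding norm_ell2 minus_ell2.rep_eq cf by (rule real_sqrt_le_mono)
      then show ?thesis using e by simp
    qed
    then show "\<exists>M. \<forall>m\<ge>M. norm (X m - Ell2 f) < e" by blast
  qed
  then show "convergent X" by (auto simp: convergent_def)
qed


text \<open>
  Elements of the function-space type are bounded real-linear maps with the operator norm; the
  algebra of bounded operators on the complex Hilbert space consists of the complex-linear ones.
\<close>

type_synonym 'a operator = "'a ell2 \<Rightarrow>\<^sub>L 'a ell2"

definition bounded_operators :: "'a operator set" where
  "bounded_operators = {T. \<forall>c f. blinfun_apply T (scaleC_ell2 c f) = scaleC_ell2 c (blinfun_apply T f)}"

definition compact_operators :: "'a operator set" where
  "compact_operators = {T \<in> bounded_operators. compact (closure (blinfun_apply T ` cball 0 1))}"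

definition operator_ring :: "'a operator set \<Rightarrow> 'a operator ring" where
  "operator_ring S = \<lparr>carrier = S, mult = (o\<^sub>L), one = id_blinfun, zero = 0, add = (+)\<rparr>"

text \<open>Multiplication operators; the definition is meaningful for bounded functions \<open>V\<close> only.\<close>

definition mult_op :: "('a \<Rightarrow> complex) \<Rightarrow> 'a operator" where
  "mult_op V = Blinfun (\<lambda>f. Ell2 (\<lambda>x. V x * coord f x))"

lemma coord_mult_op:
  assumes "bounded (range V)"
  shows "coord (blinfun_apply (mult_op V) f) x = V x * coord f x"
proof -
  obtain B where B: "\<And>x. cmod (V x) \<le> B" "0 \<le> B"
    using assms by (metis bounded_iff norm_ge_zero order_trans rangeI)
  have le: "cmod (V x * coord f x) \<le> B * cmod (coord f x)" for f x
    by (simp add: norm_mult B mult_right_mono)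
  define g where "g f = Ell2 (\<lambda>x. V x * coord f x)" for f
  have co: "coord (g f) = (\<lambda>x. V x * coord f x)" for f
    unfolding g_def by (rule Ell2_inverse) (use sq_summable_comparison[OF coord_summable le] in simp)
  have "bounded_linear g"
  proof (rule bounded_linear_intro)
    show "norm (g f) \<le> norm f * B" for f
      using norm_ell2_le_mult[of "g f" B f] le B(2)
      by (simp add: co mult.commute)
  qed (simp_all add: coord_inject[symmetric] co plus_ell2.rep_eq scaleR_ell2.rep_eq
      fun_eq_iff algebra_simps)
  then show ?thesis by (simp add: mult_op_def bounded_linear_Blinfun_apply co flip: g_def)
qed

definition scalar_op :: "complex \<Rightarrow> 'a operator" where
  "scalar_op c = mult_op (\<lambda>_. c)"

lemma scalar_op_apply: "blinfun_apply (scalar_op c) f = scaleC_ell2 c f"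
  by (simp add: scalar_op_def coord_inject[symmetric] fun_eq_iff coord_mult_op scaleC_ell2.rep_eq)

definition translation :: "'a::ab_group_add \<Rightarrow> 'a operator" where
  "translation b = Blinfun (\<lambda>f. Ell2 (\<lambda>x. coord f (x + b)))"

lemma coord_translation: "coord (blinfun_apply (translation b) f) x = coord f (x + b)"
proof -
  have bij: "bij_betw (\<lambda>x. x + b) UNIV UNIV"
    by (rule bij_betwI[where g = "\<lambda>x. x - b"]) auto
  define g where "g f = Ell2 (\<lambda>x. coord f (x + b))" for f
  have co: "coord (g f) = (\<lambda>x. coord f (x + b))" for f
    unfolding g_def by (rule Ell2_inverse)
      (use summable_on_reindex_bij_betw[OF bij, of "\<lambda>x. (cmod (coord f x))\<^sup>2"] coord_summable in simp)
  have "bounded_linear g"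
  proof (rule bounded_linear_intro)
    show "norm (g f) \<le> norm f * 1" for f
      using infsum_reindex_bij_betw[OF bij, of "\<lambda>x. (cmod (coord f x))\<^sup>2"]
      by (simp add: norm_ell2 co)
  qed (simp_all add: coord_inject[symmetric] co plus_ell2.rep_eq scaleR_ell2.rep_eq fun_eq_iff)
  then show ?thesis by (simp add: translation_def bounded_linear_Blinfun_apply co flip: g_def)
qed


text \<open>
  A complex unital algebra is given by a ring together with the map \<open>e\<close> taking \<open>c\<close> to
  \<open>c\<close> times the unit.
\<close>

definition algebra_spectrum :: "('r, 's) ring_scheme \<Rightarrow> (complex \<Rightarrow> 'r) \<Rightarrow> 'r \<Rightarrow> complex set" where
  "algebra_spectrum R e x = {c. x \<ominus>\<^bsub>R\<^esub> e c \<notin> Units R}"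

definition spectrum :: "'a operator \<Rightarrow> complex set" where
  "spectrum T = algebra_spectrum (operator_ring bounded_operators) scalar_op T"

definition quotient_spectrum :: "'a operator set \<Rightarrow> 'a operator set \<Rightarrow> 'a operator \<Rightarrow> complex set" where
  "quotient_spectrum S J T = (let R = operator_ring S in
     algebra_spectrum (R Quot J) (\<lambda>c. J +>\<^bsub>R\<^esub> scalar_op c) (J +>\<^bsub>R\<^esub> T))"

definition essential_spectrum :: "'a operator \<Rightarrow> complex set" where
  "essential_spectrum T = quotient_spectrum bounded_operators compact_operators T"


type_synonym plane = "int \<times> int"

definition proj1 :: "nat \<Rightarrow> plane operator" where
  "proj1 n = mult_op (\<lambda>(i, j). if - int n \<le> i \<and> i \<le> int n then 1 else 0)"

definition proj2 :: "nat \<Rightarrow> plane operator" where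
  "proj2 n = mult_op (\<lambda>(i, j). if - int n \<le> j \<and> j \<le> int n then 1 else 0)"

lemma coord_proj1:
  "coord (blinfun_apply (proj1 n) f) (i, j) = (if - int n \<le> i \<and> i \<le> int n then coord f (i, j) else 0)"
  unfolding proj1_def by (subst coord_mult_op) (auto intro!: boundedI[where B = 1])

lemma coord_proj2:
  "coord (blinfun_apply (proj2 n) f) (i, j) = (if - int n \<le> j \<and> j \<le> int n then coord f (i, j) else 0)"
  unfolding proj2_def by (subst coord_mult_op) (auto intro!: boundedI[where B = 1])

definition ideal1 :: "plane operator set" where
  "ideal1 = closure {T \<in> bounded_operators. \<exists>n\<ge>1. proj1 n o\<^sub>L T = T \<and> T o\<^sub>L proj1 n = T}"

definition ideal2 :: "plane operator set" where
  "ideal2 = closure {T \<in> bounded_operators. \<exists>n\<ge>1. proj2 n o\<^sub>L T = T \<and> T o\<^sub>L proj2 n = T}"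

definition multiplier_algebra :: "plane operator set" where
  "multiplier_algebra = {T \<in> bounded_operators.
     (\<forall>S\<in>ideal1. T o\<^sub>L S \<in> ideal1 \<and> S o\<^sub>L T \<in> ideal1) \<and>
     (\<forall>S\<in>ideal2. T o\<^sub>L S \<in> ideal2 \<and> S o\<^sub>L T \<in> ideal2)}"

definition spectrum1 :: "plane operator \<Rightarrow> complex set" where
  "spectrum1 T = quotient_spectrum multiplier_algebra ideal1 T"

definition spectrum2 :: "plane operator \<Rightarrow> complex set" where
  "spectrum2 T = quotient_spectrum multiplier_algebra ideal2 T"

definition periodic1 :: "plane operator \<Rightarrow> bool" where
  "periodic1 T \<longleftrightarrow> (\<exists>k\<ge>1. T o\<^sub>L translation (k, 0) = translation (k, 0) o\<^sub>L T)"

definition periodic2 :: "plane operator \<Rightarrow> bool" where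
  "periodic2 T \<longleftrightarrow> (\<exists>k\<ge>1. T o\<^sub>L translation (0, k) = translation (0, k) o\<^sub>L T)"

end

theory Submission
  imports Defs
begin

text \<open>
  Write \<open>\<J>\<^sub>1\<close>, \<open>\<J>\<^sub>2\<close> for the two ideals, \<open>\<A>\<close> for the multiplier algebra and \<open>\<K>\<close> for
  the compact operators. An element of \<open>\<J>\<^sub>1\<close> lives, up to a small error, in a strip around the
  vertical axis, an element of \<open>\<J>\<^sub>2\<close> in a strip around the horizontal axis. Two such strips meet
  in a finite box, so \<open>\<J>\<^sub>1 \<J>\<^sub>2\<close> and \<open>\<J>\<^sub>2 \<J>\<^sub>1\<close> consist of compact operators
  (\<open>strip_ideals_product_compact\<close>), while conversely every compact operator lies in both ideals
  (\<open>compact_in_strip_ideal\<close>).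

  \<^bold>\<open>The essential spectrum.\<close> Let \<open>x = H - c\<close>. If \<open>y\<close> inverts \<open>x\<close> modulo \<open>\<J>\<^sub>1\<close> and \<open>z\<close> inverts it
  modulo \<open>\<J>\<^sub>2\<close>, then \<open>w = y + z - y x z\<close> satisfies \<open>1 - x w = (1 - x y) (1 - x z)\<close> and
  \<open>1 - w x = (1 - y x) (1 - z x)\<close>, so \<open>w\<close> inverts \<open>x\<close> modulo \<open>\<K>\<close>. Conversely an inverse \<open>y\<close> of \<open>x\<close>
  modulo \<open>\<K>\<close> is an inverse modulo both ideals, provided that \<open>y\<close> belongs to \<open>\<A>\<close>. This would follow
  from the fact that the spectrum of an element does not change on passing to a \<open>C\<close>*-subalgebra; here
  there is a direct argument. Finite sums of multiplications and shifts almost commute with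
  multiplication by a function \<open>\<phi>\<close> of one coordinate that varies slowly, and the identity
  \<open>y \<phi> - \<phi> y = y [\<phi>, x] y + compact\<close> passes this property on to \<open>y\<close>. Choosing \<open>\<phi>\<close> equal to \<open>1\<close> on
  a given strip and supported in a wider one shows that \<open>y\<close> maps functions supported in the first
  strip to functions that are, up to a small error, supported in a strip
  (\<open>parametrix_strip_multiplier\<close>), and this is membership in \<open>\<A>\<close>. Together these give
  \<open>\<sigma>\<^sub>e\<^sub>s\<^sub>s(H) = \<sigma>\<^sub>1(H) \<union> \<sigma>\<^sub>2(H)\<close> (\<open>essential_spectrum_eq_Un\<close>). Since \<open>V\<^sub>2 \<in> \<J>\<^sub>1\<close> and
  \<open>V\<^sub>1 \<in> \<J>\<^sub>2\<close>, the potential \<open>V\<^sub>2\<close> may be dropped in \<open>\<sigma>\<^sub>1(H)\<close> and \<open>V\<^sub>1\<close> in \<open>\<sigma>\<^sub>2(H)\<close>.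

  \<^bold>\<open>The periodic case.\<close> Suppose that \<open>x\<close> commutes with a horizontal translation \<open>\<tau>\<close> and that \<open>y\<close>
  inverts it modulo \<open>\<J>\<^sub>1\<close>. The powers of \<open>\<tau>\<close> move every function out of all vertical strips, so
  \<open>j \<tau>\<^sup>n f \<rightarrow> 0\<close> for \<open>j \<in> \<J>\<^sub>1\<close>. Conjugating \<open>x y - 1\<close> and \<open>y x - 1\<close> by \<open>\<tau>\<^sup>n\<close> leaves \<open>x\<close> alone and
  makes the errors vanish in the limit: \<open>x\<close> is bounded below and has dense range, hence it is
  invertible (\<open>invertible_if_invertible_modulo_strip\<close>). So \<open>\<sigma>\<^sub>1\<close> is the ordinary spectrum.

  Both coordinates are treated at once by working with an integer-valued function \<open>h\<close> on the index
  set; \<open>h = fst\<close> gives \<open>\<J>\<^sub>1\<close> and \<open>h = snd\<close> gives \<open>\<J>\<^sub>2\<close>.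
\<close>

section \<open>Operators on square-summable functions\<close>

lemma ell2_eqI: "(\<And>x. coord f x = coord g x) \<Longrightarrow> f = g"
  by (simp add: coord_inject[symmetric] fun_eq_iff)

lemma norm_blinfun_le:
  assumes "norm f \<le> r" shows "norm (blinfun_apply T f) \<le> norm T * r"
  by (meson assms mult_left_mono norm_blinfun norm_ge_zero order_trans)

lemma bounded_range_if_norm_le:
  fixes V :: "'a \<Rightarrow> complex"
  assumes "\<And>x. cmod (V x) \<le> c" shows "bounded (range V)"
  using assms by (auto intro: boundedI)

lemma norm_mult_op_le:
  assumes "\<And>x. cmod (V x) \<le> c" "0 \<le> c"
  shows "norm (mult_op V) \<le> c"
proof (rule norm_blinfun_bound[OF assms(2)])
  fix f
  show "norm (blinfun_apply (mult_op V) f) \<le> c * norm f"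
    using assms by (intro norm_ell2_le_mult)
      (auto simp: coord_mult_op[OF bounded_range_if_norm_le[OF assms(1)]] norm_mult mult_right_mono)
qed

lemma norm_translation [simp]: "norm (blinfun_apply (translation b) f) = norm f"
proof -
  have "bij_betw (\<lambda>x. x + b) UNIV UNIV"
    by (rule bij_betwI[where g = "\<lambda>x. x - b"]) auto
  from infsum_reindex_bij_betw[OF this, of "\<lambda>x. (cmod (coord f x))\<^sup>2"]
  show ?thesis by (simp add: norm_ell2 coord_translation)
qed

lemma translation_inverse:
  "blinfun_apply (translation b) (blinfun_apply (translation (- b)) f) = f"
  by (rule ell2_eqI) (simp add: coord_translation)

lemma translation_add:
  "translation (b + c) = translation b o\<^sub>L translation c"
  by (rule blinfun_eqI, rule ell2_eqI) (simp add: coord_translation add.assoc)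

lemma bounded_operatorsD:
  "T \<in> bounded_operators \<Longrightarrow> blinfun_apply T (scaleC_ell2 c f) = scaleC_ell2 c (blinfun_apply T f)"
  by (simp add: bounded_operators_def)

lemma scaleC_add: "scaleC_ell2 c (f + g) = scaleC_ell2 c f + scaleC_ell2 c g"
  by (rule ell2_eqI) (simp add: scaleC_ell2.rep_eq plus_ell2.rep_eq algebra_simps)

lemma scaleC_diff: "scaleC_ell2 c (f - g) = scaleC_ell2 c f - scaleC_ell2 c g"
  by (rule ell2_eqI) (simp add: scaleC_ell2.rep_eq minus_ell2.rep_eq algebra_simps)

lemma scaleC_zero: "scaleC_ell2 c 0 = 0"
  by (rule ell2_eqI) (simp add: scaleC_ell2.rep_eq zero_ell2.rep_eq)

lemma bounded_operators_zero: "0 \<in> bounded_operators"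
  by (simp add: bounded_operators_def scaleC_zero)

lemma bounded_operators_id: "id_blinfun \<in> bounded_operators"
  by (simp add: bounded_operators_def)

lemma bounded_operators_add:
  "S \<in> bounded_operators \<Longrightarrow> T \<in> bounded_operators \<Longrightarrow> S + T \<in> bounded_operators"
  by (simp add: bounded_operators_def blinfun.add_left scaleC_add)

lemma bounded_operators_diff:
  "S \<in> bounded_operators \<Longrightarrow> T \<in> bounded_operators \<Longrightarrow> S - T \<in> bounded_operators"
  by (simp add: bounded_operators_def blinfun.diff_left scaleC_diff)

lemma bounded_operators_compose:
  "S \<in> bounded_operators \<Longrightarrow> T \<in> bounded_operators \<Longrightarrow> S o\<^sub>L T \<in> bounded_operators"
  by (simp add: bounded_operators_def)

lemma bounded_operators_mult_op:
  "bounded (range V) \<Longrightarrow> mult_op V \<in> bounded_operators"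
  unfolding bounded_operators_def
  by (auto intro!: ell2_eqI simp: coord_mult_op scaleC_ell2.rep_eq)

lemma bounded_operators_scalar: "scalar_op c \<in> bounded_operators"
  by (simp add: scalar_op_def bounded_operators_mult_op)

lemma bounded_operators_translation: "translation b \<in> bounded_operators"
  unfolding bounded_operators_def
  by (auto intro!: ell2_eqI simp: coord_translation scaleC_ell2.rep_eq)

lemmas bounded_operators_intros =
  bounded_operators_zero bounded_operators_id bounded_operators_add bounded_operators_diff
  bounded_operators_compose bounded_operators_mult_op bounded_operators_scalar
  bounded_operators_translation

lemma closed_bounded_operators: "closed (bounded_operators :: 'a operator set)"
proof -
  have "bounded_linear (\<lambda>f :: 'a ell2. scaleC_ell2 c f)" for c
    using blinfun.bounded_linear_right[of "scalar_op c"] by (simp add: scalar_op_apply)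
  then have "continuous_on UNIV (\<lambda>T :: 'a operator. scaleC_ell2 c (blinfun_apply T f))" for c f
    by (rule linear_continuous_on[OF bounded_linear_compose[OF _ bounded_linear_apply_blinfun]])
  moreover have "continuous_on UNIV (\<lambda>T :: 'a operator. blinfun_apply T f)" for f
    by (rule linear_continuous_on[OF bounded_linear_apply_blinfun])
  ultimately have "closed (\<Inter>c f. {T :: 'a operator.
      blinfun_apply T (scaleC_ell2 c f) = scaleC_ell2 c (blinfun_apply T f)})"
    by (intro closed_INT ballI closed_Collect_eq)
  also have "(\<Inter>c f. {T :: 'a operator.
      blinfun_apply T (scaleC_ell2 c f) = scaleC_ell2 c (blinfun_apply T f)}) = bounded_operators"
    by (auto simp: bounded_operators_def)
  finally show ?thesis .
qed

lemma tendsto_compose_left: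
  "(X \<longlongrightarrow> (T :: 'a operator)) F \<Longrightarrow> ((\<lambda>n. S o\<^sub>L X n) \<longlongrightarrow> S o\<^sub>L T) F"
  by (intro bounded_bilinear.tendsto[OF bounded_bilinear_blinfun_compose] tendsto_const)

lemma tendsto_compose_right:
  "(X \<longlongrightarrow> (T :: 'a operator)) F \<Longrightarrow> ((\<lambda>n. X n o\<^sub>L S) \<longlongrightarrow> T o\<^sub>L S) F"
  by (intro bounded_bilinear.tendsto[OF bounded_bilinear_blinfun_compose] tendsto_const)

lemma compose_add_left: "(S + T) o\<^sub>L (U :: 'a operator) = (S o\<^sub>L U) + (T o\<^sub>L U)"
  by (rule bounded_bilinear.add_left[OF bounded_bilinear_blinfun_compose])

lemma compose_add_right: "(U :: 'a operator) o\<^sub>L (S + T) = (U o\<^sub>L S) + (U o\<^sub>L T)"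
  by (rule bounded_bilinear.add_right[OF bounded_bilinear_blinfun_compose])

lemma compose_diff_left: "(S - T) o\<^sub>L (U :: 'a operator) = (S o\<^sub>L U) - (T o\<^sub>L U)"
  by (rule bounded_bilinear.diff_left[OF bounded_bilinear_blinfun_compose])

lemma compose_diff_right: "(U :: 'a operator) o\<^sub>L (S - T) = (U o\<^sub>L S) - (U o\<^sub>L T)"
  by (rule bounded_bilinear.diff_right[OF bounded_bilinear_blinfun_compose])

lemma compose_assoc: "(S o\<^sub>L T) o\<^sub>L U = S o\<^sub>L (T o\<^sub>L (U :: 'a operator))"
  by (rule blinfun_eqI) simp

lemmas compose_simps =
  compose_add_left compose_add_right compose_diff_left compose_diff_right compose_assoc

lemma compose_id [simp]:
  "id_blinfun o\<^sub>L (T :: 'a operator) = T" "T o\<^sub>L id_blinfun = T"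
  by (auto intro: blinfun_eqI)

section \<open>Compact operators\<close>

text \<open>
  The image of the unit ball lies in a complete space, so its closure is compact as soon as it is
  covered by finitely many balls of every radius. All closure properties below use this form.
\<close>

lemma compact_operators_iff:
  "T \<in> compact_operators \<longleftrightarrow> T \<in> bounded_operators \<and>
    (\<forall>e>0. \<exists>K. finite K \<and> blinfun_apply T ` cball 0 1 \<subseteq> (\<Union>g\<in>K. ball g e))"
  (is "_ \<longleftrightarrow> _ \<and> ?tb")
proof -
  let ?S = "blinfun_apply T ` cball 0 1"
  have "compact (closure ?S) \<longleftrightarrow> ?tb"
  proof
    assume "compact (closure ?S)"
    then show ?tb
      using closure_subset[of ?S] unfolding compact_eq_totally_bounded by fast
  next
    assume tb: ?tb
    have "\<exists>K. finite K \<and> closure ?S \<subseteq> (\<Union>g\<in>K. ball g e)" if "e > 0" for e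
    proof -
      have "\<exists>K. finite K \<and> ?S \<subseteq> (\<Union>g\<in>K. ball g (e/2))"
        using tb half_gt_zero[OF that] by simp
      then obtain K where K: "finite K" "?S \<subseteq> (\<Union>g\<in>K. ball g (e/2))"
        by (elim exE conjE)
      have "closed (\<Union>g\<in>K. cball g (e/2))"
        by (rule closed_UN[OF K(1)]) simp
      moreover have "?S \<subseteq> (\<Union>g\<in>K. cball g (e/2))"
        by (rule order_trans[OF K(2)]) (intro UN_mono ball_subset_cball order_refl)
      ultimately have "closure ?S \<subseteq> (\<Union>g\<in>K. cball g (e/2))"
        by (simp add: closure_minimal)
      also have "\<dots> \<subseteq> (\<Union>g\<in>K. ball g e)"
        using that by (intro UN_mono) auto
      finally show ?thesis using K(1) by blast
    qed
    then show "compact (closure ?S)"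
      unfolding compact_eq_totally_bounded by (simp add: complete_eq_closed)
  qed
  then show ?thesis by (simp add: compact_operators_def)
qed

lemma compact_subset_bounded: "T \<in> compact_operators \<Longrightarrow> T \<in> bounded_operators"
  by (simp add: compact_operators_iff)

lemma compact_net:
  assumes "T \<in> compact_operators" "0 < e"
  obtains K where "finite K" "\<And>f. norm f \<le> 1 \<Longrightarrow> \<exists>g\<in>K. norm (blinfun_apply T f - g) < e"
proof -
  obtain K where K: "finite K" "blinfun_apply T ` cball 0 1 \<subseteq> (\<Union>g\<in>K. ball g e)"
    using assms by (auto simp: compact_operators_iff)
  have "\<exists>g\<in>K. norm (blinfun_apply T f - g) < e" if "norm f \<le> 1" for f
    using K(2) that by (fastforce simp: dist_norm norm_minus_commute)
  then show ?thesis using that K(1) by blast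
qed

lemma compactI_net:
  assumes "T \<in> bounded_operators"
    and "\<And>e. 0 < e \<Longrightarrow> \<exists>K. finite K \<and> (\<forall>f. norm f \<le> 1 \<longrightarrow> (\<exists>g\<in>K. norm (blinfun_apply T f - g) < e))"
  shows "T \<in> compact_operators"
  unfolding compact_operators_iff
proof (intro conjI allI impI assms(1))
  fix e :: real assume "0 < e"
  from assms(2)[OF this] obtain K where "finite K"
    "\<And>f. norm f \<le> 1 \<Longrightarrow> \<exists>g\<in>K. norm (blinfun_apply T f - g) < e" by blast
  then show "\<exists>K. finite K \<and> blinfun_apply T ` cball 0 1 \<subseteq> (\<Union>g\<in>K. ball g e)"
    by (intro exI[of _ K]) (auto simp: dist_norm norm_minus_commute)
qed

text \<open>
  A net for a nearby compact operator is a net for the given one: the compact operators are closed in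
  norm.
\<close>

lemma compactI_approx:
  assumes "T \<in> bounded_operators"
    and "\<And>e. 0 < e \<Longrightarrow> \<exists>S\<in>compact_operators. norm (T - S) < e"
  shows "T \<in> compact_operators"
proof (rule compactI_net[OF assms(1)])
  fix e :: real assume "0 < e"
  then obtain S where S: "S \<in> compact_operators" "norm (T - S) < e / 2"
    using assms(2)[of "e/2"] by auto
  obtain K where K: "finite K" "\<And>f. norm f \<le> 1 \<Longrightarrow> \<exists>g\<in>K. norm (blinfun_apply S f - g) < e / 2"
    using compact_net[OF S(1), of "e/2"] \<open>0 < e\<close> by auto
  have "\<exists>g\<in>K. norm (blinfun_apply T f - g) < e" if "norm f \<le> 1" for f
  proof -
    obtain g where g: "g \<in> K" "norm (blinfun_apply S f - g) < e / 2"
      using K(2) \<open>norm f \<le> 1\<close> by blast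
    have "norm (blinfun_apply T f - blinfun_apply S f) \<le> norm (T - S) * 1"
      using norm_blinfun_le[OF that, of "T - S"] by (simp add: blinfun.diff_left)
    then have "norm (blinfun_apply T f - g) < e"
      using g(2) S(2) norm_triangle_ineq[of "blinfun_apply T f - blinfun_apply S f" "blinfun_apply S f - g"]
      by simp
    then show ?thesis using g(1) by blast
  qed
  then show "\<exists>K. finite K \<and> (\<forall>f. norm f \<le> 1 \<longrightarrow> (\<exists>g\<in>K. norm (blinfun_apply T f - g) < e))"
    using K(1) by blast
qed

lemma compact_add:
  assumes "S \<in> compact_operators" "T \<in> compact_operators"
  shows "S + T \<in> compact_operators"
proof (rule compactI_net)
  show "S + T \<in> bounded_operators"
    using assms compact_subset_bounded by (blast intro: bounded_operators_intros)
  fix e :: real assume "0 < e"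
  then have e: "0 < e / 2" by simp
  obtain K where K: "finite K" "\<And>f. norm f \<le> 1 \<Longrightarrow> \<exists>g\<in>K. norm (blinfun_apply S f - g) < e / 2"
    using compact_net[OF assms(1) e] by blast
  obtain L where L: "finite L" "\<And>f. norm f \<le> 1 \<Longrightarrow> \<exists>g\<in>L. norm (blinfun_apply T f - g) < e / 2"
    using compact_net[OF assms(2) e] by blast
  have "\<exists>k\<in>(\<lambda>(g, h). g + h) ` (K \<times> L). norm (blinfun_apply (S + T) f - k) < e"
    if "norm f \<le> 1" for f
  proof -
    obtain g h where gh: "g \<in> K" "h \<in> L"
      "norm (blinfun_apply S f - g) < e / 2" "norm (blinfun_apply T f - h) < e / 2"
      using K(2) L(2) \<open>norm f \<le> 1\<close> by blast
    have eq: "blinfun_apply (S + T) f - (g + h) = (blinfun_apply S f - g) + (blinfun_apply T f - h)"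
      by (simp add: blinfun.add_left)
    have "norm (blinfun_apply (S + T) f - (g + h)) < e"
      unfolding eq
      using gh(3,4) norm_triangle_ineq[of "blinfun_apply S f - g" "blinfun_apply T f - h"] by linarith
    then show ?thesis using gh(1,2) by force
  qed
  then show "\<exists>K. finite K \<and> (\<forall>f. norm f \<le> 1 \<longrightarrow> (\<exists>g\<in>K. norm (blinfun_apply (S + T) f - g) < e))"
    using K(1) L(1) by (intro exI[of _ "(\<lambda>(g, h). g + h) ` (K \<times> L)"]) blast
qed

lemma compact_compose_left:
  assumes "S \<in> bounded_operators" "T \<in> compact_operators"
  shows "S o\<^sub>L T \<in> compact_operators"
proof (rule compactI_net)
  show "S o\<^sub>L T \<in> bounded_operators"
    using assms compact_subset_bounded by (blast intro: bounded_operators_intros)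
  fix e :: real assume "0 < e"
  then have "0 < e / (norm S + 1)" by (simp add: add_nonneg_pos)
  then obtain K where K: "finite K"
    "\<And>f. norm f \<le> 1 \<Longrightarrow> \<exists>g\<in>K. norm (blinfun_apply T f - g) < e / (norm S + 1)"
    using compact_net[OF assms(2)] by blast
  have "\<exists>k\<in>blinfun_apply S ` K. norm (blinfun_apply (S o\<^sub>L T) f - k) < e" if f: "norm f \<le> 1" for f
  proof -
    obtain g where g: "g \<in> K" "norm (blinfun_apply T f - g) < e / (norm S + 1)"
      using K(2) f by blast
    have "norm (blinfun_apply (S o\<^sub>L T) f - blinfun_apply S g) \<le> norm S * norm (blinfun_apply T f - g)"
      using norm_blinfun[of S "blinfun_apply T f - g"] by (simp add: blinfun.diff_right)
    also have "\<dots> \<le> (norm S + 1) * norm (blinfun_apply T f - g)"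
      by (simp add: mult_right_mono)
    also have "\<dots> < e"
      using g(2) by (simp add: pos_less_divide_eq add_nonneg_pos mult.commute)
    finally show ?thesis using g(1) by blast
  qed
  then show "\<exists>K. finite K \<and> (\<forall>f. norm f \<le> 1 \<longrightarrow> (\<exists>g\<in>K. norm (blinfun_apply (S o\<^sub>L T) f - g) < e))"
    using K(1) by (intro exI[of _ "blinfun_apply S ` K"]) blast
qed

lemma compact_compose_right:
  assumes "S \<in> compact_operators" "T \<in> bounded_operators"
  shows "S o\<^sub>L T \<in> compact_operators"
proof (rule compactI_net)
  show "S o\<^sub>L T \<in> bounded_operators"
    using assms compact_subset_bounded by (blast intro: bounded_operators_intros)
  fix e :: real assume "0 < e"
  define c where "c = norm T + 1"
  have c: "0 < c" by (simp add: c_def add_nonneg_pos)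
  then obtain K where K: "finite K" "\<And>f. norm f \<le> 1 \<Longrightarrow> \<exists>g\<in>K. norm (blinfun_apply S f - g) < e / c"
    using compact_net[OF assms(1), of "e / c"] \<open>0 < e\<close> by auto
  have "\<exists>k\<in>(\<lambda>g. c *\<^sub>R g) ` K. norm (blinfun_apply (S o\<^sub>L T) f - k) < e" if f: "norm f \<le> 1" for f
  proof -
    have "norm (blinfun_apply T f) \<le> c"
      using norm_blinfun_le[OF f, of T] by (simp add: c_def)
    then have "norm ((1 / c) *\<^sub>R blinfun_apply T f) \<le> 1"
      using c by (simp add: field_simps)
    then obtain g where g: "g \<in> K" "norm (blinfun_apply S ((1 / c) *\<^sub>R blinfun_apply T f) - g) < e / c"
      using K(2) by blast
    have eq: "blinfun_apply (S o\<^sub>L T) f - c *\<^sub>R g = c *\<^sub>R (blinfun_apply S ((1 / c) *\<^sub>R blinfun_apply T f) - g)"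
      using c by (simp add: blinfun.scaleR_right scaleR_right_diff_distrib)
    have "norm (blinfun_apply (S o\<^sub>L T) f - c *\<^sub>R g) < e"
      unfolding eq norm_scaleR using g(2) c by (simp add: pos_less_divide_eq mult.commute)
    then show ?thesis using g(1) by blast
  qed
  then show "\<exists>K. finite K \<and> (\<forall>f. norm f \<le> 1 \<longrightarrow> (\<exists>g\<in>K. norm (blinfun_apply (S o\<^sub>L T) f - g) < e))"
    using K(1) by (intro exI[of _ "(\<lambda>g. c *\<^sub>R g) ` K"]) blast
qed

lemma compact_zero: "0 \<in> compact_operators"
  by (rule compactI_net) (auto simp: bounded_operators_intros intro!: exI[of _ "{0}"])

lemma coord_sum: "finite I \<Longrightarrow> coord (\<Sum>i\<in>I. u i) x = (\<Sum>i\<in>I. coord (u i) x)"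
  by (induction I rule: finite_induct) (auto simp: plus_ell2.rep_eq zero_ell2.rep_eq)

text \<open>
  The image of the unit ball consists of sums of finitely many multiples, with bounded coefficients, of
  unit vectors, and these sums form a compact set.
\<close>

lemma compact_mult_op_finite_support:
  assumes "finite F" "\<And>x. x \<notin> F \<Longrightarrow> V x = 0"
  shows "mult_op V \<in> compact_operators"
proof -
  have bd: "bounded (range V)"
    by (rule finite_imp_bounded, rule finite_subset[of _ "insert 0 (V ` F)"]) (use assms in auto)
  define \<delta> :: "'a \<Rightarrow> complex \<Rightarrow> 'a ell2"
    where "\<delta> y c = scaleC_ell2 c (Ell2 (\<lambda>x. if x = y then 1 else 0))" for y c
  have co: "coord (\<delta> y c) x = (if x = y then c else 0)" for x y c
  proof -
    have "(\<lambda>x. (cmod (if x = y then 1 else 0))\<^sup>2) summable_on UNIV"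
      by (rule finite_nonzero_values_imp_summable_on) (auto intro: finite_subset[of _ "{y}"])
    then show ?thesis by (simp add: \<delta>_def scaleC_ell2.rep_eq Ell2_inverse)
  qed
  have norm_\<delta>: "norm (\<delta> y c) = cmod c" for y c
  proof -
    have "(\<Sum>\<^sub>\<infinity>x. (cmod (if x = y then c else 0))\<^sup>2) = (\<Sum>\<^sub>\<infinity>x\<in>{y}. (cmod c)\<^sup>2)"
      by (rule infsum_cong_neutral) auto
    then show ?thesis by (simp add: norm_ell2 co)
  qed
  have "bounded_linear (\<delta> y)" for y
    by (rule bounded_linear_intro[where K = 1])
      (auto intro!: ell2_eqI simp: co plus_ell2.rep_eq scaleR_ell2.rep_eq norm_\<delta>)
  then have cpt: "compact (\<delta> y ` cball 0 r)" for y r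
    by (intro compact_continuous_image linear_continuous_on compact_cball)
  define r where "r = norm (mult_op V)"
  \<comment> \<open>A sum of two compact sets is compact, so the points can be added one at a time.\<close>
  have "\<exists>C. compact C \<and> (\<forall>u. (\<forall>y\<in>G. cmod (u y) \<le> r) \<longrightarrow> (\<Sum>y\<in>G. \<delta> y (u y)) \<in> C)"
    if "finite G" for G
    using that
  proof induction
    case empty
    then show ?case by (intro exI[of _ "{0}"]) auto
  next
    case (insert y G)
    then obtain C where C: "compact C" "\<And>u. (\<forall>y\<in>G. cmod (u y) \<le> r) \<Longrightarrow> (\<Sum>y\<in>G. \<delta> y (u y)) \<in> C"
      by blast
    show ?case
      using insert.hyps C compact_sums[OF cpt[of y r] C(1)]
      by (intro exI[of _ "{a + b |a b. a \<in> \<delta> y ` cball 0 r \<and> b \<in> C}"]) fastforce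
  qed
  from this[OF assms(1)] obtain C where C: "compact C"
    "\<And>u. (\<forall>y\<in>F. cmod (u y) \<le> r) \<Longrightarrow> (\<Sum>y\<in>F. \<delta> y (u y)) \<in> C" by blast
  have "blinfun_apply (mult_op V) ` cball 0 1 \<subseteq> C"
  proof (rule image_subsetI)
    fix f :: "'a ell2" assume "f \<in> cball 0 1"
    let ?g = "blinfun_apply (mult_op V) f"
    have "norm ?g \<le> r"
      using norm_blinfun_le[of f 1 "mult_op V"] \<open>f \<in> cball 0 1\<close> by (simp add: r_def)
    then have "cmod (coord ?g y) \<le> r" for y
      using norm_coord_le[of ?g y] by simp
    moreover have "?g = (\<Sum>y\<in>F. \<delta> y (coord ?g y))"
      using assms by (intro ell2_eqI) (auto simp: coord_sum co coord_mult_op[OF bd] sum.delta')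
    ultimately show "?g \<in> C" using C(2)[of "coord ?g"] by simp
  qed
  then have "closure (blinfun_apply (mult_op V) ` cball 0 1) \<subseteq> C"
    using C(1) by (simp add: closure_minimal compact_imp_closed)
  then have "compact (closure (blinfun_apply (mult_op V) ` cball 0 1))"
    using compact_Int_closed[OF C(1) closed_closure, of "blinfun_apply (mult_op V) ` cball 0 1"]
    by (simp add: Int_absorb1)
  then show ?thesis
    by (simp add: compact_operators_def bounded_operators_mult_op[OF bd])
qed


lemma norm_blinfun_bound_unit:
  assumes "0 \<le> b" "\<And>f. norm f = 1 \<Longrightarrow> norm (blinfun_apply T f) \<le> b"
  shows "norm T \<le> b"
proof (rule norm_blinfun_bound[OF assms(1)])
  fix f
  show "norm (blinfun_apply T f) \<le> b * norm f"
  proof (cases "f = 0")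
    case False
    then have "norm (blinfun_apply T (f /\<^sub>R norm f)) \<le> b"
      by (intro assms(2)) simp
    then show ?thesis using False by (simp add: blinfun.scaleR_right field_simps)
  qed simp
qed

text \<open>
  The representing vector minimises \<open>\<parallel>f\<parallel>\<^sup>2 - 2 l f\<close>. By the parallelogram law a minimising sequence is
  a Cauchy sequence, and the vanishing of the first variation at the minimum is the representation.
  The result serves to control \<open>T (1 - P)\<close> for compact \<open>T\<close> and a projection \<open>P\<close> without
  constructing adjoints.
\<close>

lemma riesz_representation:
  fixes l :: "'b::{real_inner,banach} \<Rightarrow> real"
  assumes "bounded_linear l"
  obtains v where "\<And>f. l f = inner v f"
proof -
  interpret bounded_linear l by (rule assms)
  define q where "q f = (norm f)\<^sup>2 - 2 * l f" for f
  obtain K where K: "\<And>f. norm (l f) \<le> norm f * K"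
    using bounded by blast
  have "- K\<^sup>2 \<le> q f" for f
  proof -
    have "2 * l f \<le> 2 * (norm f * K)"
      using K[of f] by (simp add: abs_le_iff)
    then show ?thesis
      using zero_le_power2[of "norm f - K"] by (simp add: q_def power2_diff)
  qed
  then have bdd: "bdd_below (range q)"
    by (auto intro: bdd_belowI[of _ "- K\<^sup>2"])
  define m where "m = Inf (range q)"
  have m_le: "m \<le> q f" for f
    unfolding m_def by (rule cInf_lower[OF _ bdd]) simp
  have "\<exists>f. q f < m + inverse (Suc n)" for n
    using cInf_lessD[of "range q" "m + inverse (Suc n)"] by (auto simp: m_def)
  then obtain u where u: "\<And>n. q (u n) < m + inverse (Suc n)" by metis
  have close: "(norm (f - g))\<^sup>2 \<le> 2 * (q f - m) + 2 * (q g - m)" for f g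
  proof -
    have "q f + q g = 2 * q ((1/2) *\<^sub>R (f + g)) + (norm (f - g))\<^sup>2 / 2"
      by (simp add: q_def add scaleR power2_norm_eq_inner inner_add_left inner_add_right
          inner_diff_left inner_diff_right inner_commute power_divide field_simps)
    then show ?thesis using m_le[of "(1/2) *\<^sub>R (f + g)"] by simp
  qed
  have "Cauchy u"
  proof (rule CauchyI)
    fix e :: real assume "0 < e"
    then obtain M where M: "inverse (real (Suc M)) < e\<^sup>2 / 4"
      using reals_Archimedean[of "e\<^sup>2 / 4"] by auto
    have "norm (u i - u j) < e" if "M \<le> i" "M \<le> j" for i j
    proof -
      have "q (u k) - m < e\<^sup>2 / 4" if "M \<le> k" for k
      proof -
        have "inverse (real (Suc k)) \<le> inverse (real (Suc M))"
          using that by (intro le_imp_inverse_le) auto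
        then show ?thesis using u[of k] M by linarith
      qed
      from this[OF that(1)] this[OF that(2)] have "(norm (u i - u j))\<^sup>2 < e\<^sup>2"
        using close[of "u i" "u j"] by argo
      then show ?thesis
        by (rule power_less_imp_less_base) (use \<open>0 < e\<close> in simp)
    qed
    then show "\<exists>M. \<forall>i\<ge>M. \<forall>j\<ge>M. norm (u i - u j) < e" by blast
  qed
  then obtain v where v: "u \<longlonglongrightarrow> v"
    by (auto simp: Cauchy_convergent_iff convergent_def)
  then have "(\<lambda>n. q (u n)) \<longlonglongrightarrow> q v"
    unfolding q_def by (intro tendsto_intros tendsto)
  moreover have "(\<lambda>n. m + inverse (Suc n)) \<longlonglongrightarrow> m + 0"
    by (intro tendsto_intros LIMSEQ_inverse_real_of_nat)
  ultimately have "q v \<le> m"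
    using LIMSEQ_le[of "\<lambda>n. q (u n)" "q v"] less_imp_le[OF u] by simp
  have "l f = inner v f" for f
  proof -
    define d where "d = inner v f - l f"
    define N where "N = (norm f)\<^sup>2"
    have N: "0 \<le> N" by (simp add: N_def)
    have min: "0 \<le> 2 * t * d + t\<^sup>2 * N" for t
    proof -
      have "q (v + t *\<^sub>R f) = q v + 2 * t * d + t\<^sup>2 * N"
      proof -
        have "(norm (v + t *\<^sub>R f))\<^sup>2 = (norm v)\<^sup>2 + 2 * t * inner v f + t\<^sup>2 * N"
          unfolding N_def power2_norm_eq_inner
          by (simp add: inner_add_left inner_add_right inner_commute[of f v] power2_eq_square[of t] distrib_left)
        then show ?thesis by (simp add: q_def d_def add scaleR right_diff_distrib)
      qed
      then show ?thesis using m_le[of "v + t *\<^sub>R f"] \<open>q v \<le> m\<close> by linarith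
    qed
    \<comment> \<open>The step \<open>t = - d / (N + 1)\<close> makes the linear term in \<open>min\<close> win over the quadratic one,
      unless \<open>d = 0\<close>.\<close>
    define s where "s = d / (N + 1)"
    have d: "d = s * (N + 1)" using N by (simp add: s_def)
    have "0 \<le> - (s\<^sup>2 * (N + 2))"
      using min[of "- s"] by (simp add: d power2_eq_square algebra_simps)
    then have "s = 0"
      using N by (simp add: mult_le_0_iff)
    then have "d = 0" by (simp add: d)
    then show ?thesis by (simp add: d_def)
  qed
  then show ?thesis using that by blast
qed

section \<open>Strips\<close>

definition strip :: "('a \<Rightarrow> int) \<Rightarrow> nat \<Rightarrow> 'a operator" where
  "strip h n = mult_op (\<lambda>x. if \<bar>h x\<bar> \<le> int n then 1 else 0)"

lemma bounded_indicator: "bounded (range (\<lambda>x. if P x then 1 else (0 :: complex)))"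
  by (rule bounded_range_if_norm_le[of _ 1]) simp

lemma coord_strip:
  "coord (blinfun_apply (strip h n) f) x = (if \<bar>h x\<bar> \<le> int n then coord f x else 0)"
  by (simp add: strip_def coord_mult_op[OF bounded_indicator])

lemma norm_strip_le: "norm (strip h n) \<le> 1"
  unfolding strip_def by (rule norm_mult_op_le) auto

lemma strip_bounded: "strip h n \<in> bounded_operators"
  unfolding strip_def by (intro bounded_operators_mult_op bounded_indicator)

lemma strip_strip: "strip h m o\<^sub>L strip h n = strip h (min m n)"
  by (rule blinfun_eqI, rule ell2_eqI) (auto simp: coord_strip)

lemma inner_strip:
  "inner (blinfun_apply (strip h n) f) g = inner f (blinfun_apply (strip h n) g)"
  by (simp add: inner_ell2.rep_eq coord_strip if_distrib[of "\<lambda>z. inner z _"]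
      if_distrib[of "inner _"] cong: if_cong)

text \<open>
  Only the part of \<open>f\<close> outside a finite set has to be small, and a finite set lies in every
  sufficiently wide strip.
\<close>

lemma strip_tendsto: "(\<lambda>n. blinfun_apply (strip h n) f) \<longlonglongrightarrow> f"
proof (rule LIMSEQ_I)
  fix e :: real assume "0 < e"
  let ?s = "\<lambda>x. (cmod (coord f x))\<^sup>2"
  have "0 < e\<^sup>2 / 2" using \<open>0 < e\<close> by simp
  then obtain F where F: "finite F" "dist (sum ?s F) (infsum ?s UNIV) \<le> e\<^sup>2 / 2"
    using infsum_finite_approximation[OF coord_summable, of "e\<^sup>2 / 2" f] by blast
  have "norm (blinfun_apply (strip h n) f - f) < e"
    if n: "n \<ge> Max (insert 0 ((\<lambda>x. nat \<bar>h x\<bar>) ` F))" for n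
  proof -
    have in_strip: "\<bar>h x\<bar> \<le> int n" if "x \<in> F" for x
      using n F(1) that by (auto simp: nat_le_iff)
    have "(\<Sum>\<^sub>\<infinity>x. (cmod (coord (blinfun_apply (strip h n) f - f) x))\<^sup>2) \<le> (\<Sum>\<^sub>\<infinity>x\<in>UNIV - F. ?s x)"
      using in_strip
      by (intro infsum_mono_neutral summable_on_subset_banach[OF coord_summable] coord_summable)
        (auto simp: minus_ell2.rep_eq coord_strip)
    also have "\<dots> = infsum ?s UNIV - sum ?s F"
      by (subst infsum_Diff) (use F(1) coord_summable in auto)
    also have "\<dots> \<le> e\<^sup>2 / 2"
      using F(2) unfolding dist_real_def by linarith
    also have "\<dots> < e\<^sup>2" using \<open>0 < e\<close> by simp
    finally have "norm (blinfun_apply (strip h n) f - f) < sqrt (e\<^sup>2)"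
      unfolding norm_ell2 by (rule real_sqrt_less_mono)
    then show ?thesis using \<open>0 < e\<close> by simp
  qed
  then show "\<exists>N. \<forall>n\<ge>N. norm (blinfun_apply (strip h n) f - f) < e" by blast
qed

text \<open>
  These are the closed right and left ideals of operators whose range, respectively whose dependence on
  the argument, is concentrated near the set where \<open>h\<close> vanishes. Their intersection with the
  complex-linear operators is the ideal of the strips; each half is easier to handle than the whole.
\<close>

definition left_supported :: "('a \<Rightarrow> int) \<Rightarrow> 'a operator set" where
  "left_supported h = {T. (\<lambda>n. strip h n o\<^sub>L T) \<longlonglongrightarrow> T}"

definition right_supported :: "('a \<Rightarrow> int) \<Rightarrow> 'a operator set" where
  "right_supported h = {T. (\<lambda>n. T o\<^sub>L strip h n) \<longlonglongrightarrow> T}"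

text \<open>
  Strong convergence of contractions to the identity passes to norm limits.
\<close>

lemma tendsto_operators_uniform:
  fixes F :: "nat \<Rightarrow> 'a operator \<Rightarrow> 'a operator"
  assumes "\<And>n S. norm (F n S) \<le> norm S" "\<And>n S S'. F n (S - S') = F n S - F n S'"
    and "\<And>k. (\<lambda>n. F n (X k)) \<longlonglongrightarrow> X k" "X \<longlonglongrightarrow> T"
  shows "(\<lambda>n. F n T) \<longlonglongrightarrow> T"
proof (rule LIMSEQ_I)
  fix e :: real assume "0 < e"
  then have e: "0 < e / 3" by simp
  obtain k where k: "norm (X k - T) < e / 3"
    using LIMSEQ_D[OF assms(4) e] by blast
  obtain N where N: "\<And>n. n \<ge> N \<Longrightarrow> norm (F n (X k) - X k) < e / 3"
    using LIMSEQ_D[OF assms(3) e] by blast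
  have "norm (F n T - T) < e" if "n \<ge> N" for n
  proof -
    have "F n T - T = (F n (X k) - X k) + (X k - T) - F n (X k - T)"
      by (simp add: assms(2))
    also have "norm \<dots> \<le> norm (F n (X k) - X k) + norm (X k - T) + norm (F n (X k - T))"
      by (meson norm_triangle_ineq norm_triangle_ineq4 order_trans add_right_mono)
    finally show ?thesis
      using N[OF that] k assms(1)[of n "X k - T"] by linarith
  qed
  then show "\<exists>N. \<forall>n\<ge>N. norm (F n T - T) < e" by blast
qed

lemma norm_strip_compose:
  "norm (strip h n o\<^sub>L T) \<le> norm T" "norm (T o\<^sub>L strip h n) \<le> norm T"
proof -
  show "norm (strip h n o\<^sub>L T) \<le> norm T"
    using norm_blinfun_compose[of "strip h n" T] mult_right_mono[OF norm_strip_le[of h n], of "norm T"]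
    by simp
  show "norm (T o\<^sub>L strip h n) \<le> norm T"
    using norm_blinfun_compose[of T "strip h n"] mult_left_mono[OF norm_strip_le[of h n], of "norm T"]
    by simp
qed

lemma left_supported_closed:
  assumes "\<And>k. X k \<in> left_supported h" "X \<longlonglongrightarrow> T"
  shows "T \<in> left_supported h"
  unfolding left_supported_def mem_Collect_eq
  by (rule tendsto_operators_uniform[of "\<lambda>n S. strip h n o\<^sub>L S" X])
    (use assms in \<open>auto simp: norm_strip_compose compose_diff_right left_supported_def\<close>)

lemma right_supported_closed:
  assumes "\<And>k. X k \<in> right_supported h" "X \<longlonglongrightarrow> T"
  shows "T \<in> right_supported h"
  unfolding right_supported_def mem_Collect_eq
  by (rule tendsto_operators_uniform[of "\<lambda>n S. S o\<^sub>L strip h n" X])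
    (use assms in \<open>auto simp: norm_strip_compose compose_diff_left right_supported_def\<close>)

lemma left_supported_add:
  "S \<in> left_supported h \<Longrightarrow> T \<in> left_supported h \<Longrightarrow> S + T \<in> left_supported h"
  by (auto simp: left_supported_def compose_add_right intro: tendsto_add)

lemma left_supported_diff:
  "S \<in> left_supported h \<Longrightarrow> T \<in> left_supported h \<Longrightarrow> S - T \<in> left_supported h"
  by (auto simp: left_supported_def compose_diff_right intro: tendsto_diff)

lemma right_supported_add:
  "S \<in> right_supported h \<Longrightarrow> T \<in> right_supported h \<Longrightarrow> S + T \<in> right_supported h"
  by (auto simp: right_supported_def compose_add_left intro: tendsto_add)

lemma right_supported_diff:
  "S \<in> right_supported h \<Longrightarrow> T \<in> right_supported h \<Longrightarrow> S - T \<in> right_supported h"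
  by (auto simp: right_supported_def compose_diff_left intro: tendsto_diff)

lemma left_supported_compose: "S \<in> left_supported h \<Longrightarrow> S o\<^sub>L T \<in> left_supported h"
  using tendsto_compose_right[of "\<lambda>n. strip h n o\<^sub>L S" S sequentially T]
  by (simp add: left_supported_def compose_assoc)

lemma right_supported_compose: "S \<in> right_supported h \<Longrightarrow> T o\<^sub>L S \<in> right_supported h"
  using tendsto_compose_left[of "\<lambda>n. S o\<^sub>L strip h n" S sequentially T]
  by (simp add: right_supported_def compose_assoc)

lemma left_supportedI:
  assumes "strip h n o\<^sub>L T = T" shows "T \<in> left_supported h"
proof -
  have "strip h k o\<^sub>L T = T" if "k \<ge> n" for k
  proof -
    have "strip h k o\<^sub>L T = (strip h k o\<^sub>L strip h n) o\<^sub>L T"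
      by (simp add: compose_assoc assms)
    then show ?thesis using that by (simp add: strip_strip min_def assms split: if_splits)
  qed
  then have "eventually (\<lambda>k. strip h k o\<^sub>L T = T) sequentially"
    by (auto simp: eventually_sequentially)
  then show ?thesis by (simp add: left_supported_def tendsto_eventually)
qed

lemma right_supportedI:
  assumes "T o\<^sub>L strip h n = T" shows "T \<in> right_supported h"
proof -
  have "T o\<^sub>L strip h k = T" if "k \<ge> n" for k
  proof -
    have "T o\<^sub>L strip h k = T o\<^sub>L (strip h n o\<^sub>L strip h k)"
      by (simp add: compose_assoc[symmetric] assms)
    then show ?thesis using that by (simp add: strip_strip min_def assms split: if_splits)
  qed
  then have "eventually (\<lambda>k. T o\<^sub>L strip h k = T) sequentially"
    by (auto simp: eventually_sequentially)
  then show ?thesis by (simp add: right_supported_def tendsto_eventually)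
qed

text \<open>
  On a finite net of the image of the unit ball the projections converge uniformly.
\<close>

lemma compact_left_supported:
  assumes "T \<in> compact_operators" shows "T \<in> left_supported h"
  unfolding left_supported_def mem_Collect_eq
proof (rule LIMSEQ_I)
  fix e :: real assume "0 < e"
  then have e: "0 < e / 4" by simp
  obtain K where K: "finite K" "\<And>f. norm f \<le> 1 \<Longrightarrow> \<exists>g\<in>K. norm (blinfun_apply T f - g) < e / 4"
    using compact_net[OF assms e] by blast
  have "eventually (\<lambda>n. \<forall>g\<in>K. norm (blinfun_apply (strip h n) g - g) < e / 4) sequentially"
    by (rule eventually_ball_finite[OF K(1)])
      (use tendstoD[OF strip_tendsto e] in \<open>auto simp: dist_norm\<close>)
  then obtain N where N: "\<And>n g. n \<ge> N \<Longrightarrow> g \<in> K \<Longrightarrow> norm (blinfun_apply (strip h n) g - g) < e / 4"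
    by (auto simp: eventually_sequentially)
  have "norm ((strip h n o\<^sub>L T) - T) < e" if "n \<ge> N" for n
  proof -
    have "norm (blinfun_apply ((strip h n o\<^sub>L T) - T) f) \<le> 3 / 4 * e" if f: "norm f = 1" for f
    proof -
      obtain g where g: "g \<in> K" "norm (blinfun_apply T f - g) < e / 4" using K(2)[of f] f by auto
      let ?d = "blinfun_apply T f - g"
      have "blinfun_apply ((strip h n o\<^sub>L T) - T) f
          = (blinfun_apply (strip h n) g - g) + blinfun_apply (strip h n) ?d - ?d"
        by (simp add: blinfun.diff_left blinfun.diff_right)
      also have "norm \<dots> \<le> norm (blinfun_apply (strip h n) g - g) + norm (blinfun_apply (strip h n) ?d) + norm ?d"
        by (meson norm_triangle_ineq norm_triangle_ineq4 order_trans add_right_mono)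
      also have "\<dots> \<le> e / 4 + e / 4 + e / 4"
        using N[OF \<open>n \<ge> N\<close> g(1)] g(2) norm_blinfun[of "strip h n" ?d]
          mult_right_mono[OF norm_strip_le[of h n], of "norm ?d"] by simp
      finally show ?thesis by simp
    qed
    then have "norm ((strip h n o\<^sub>L T) - T) \<le> 3 / 4 * e"
      using \<open>0 < e\<close> by (intro norm_blinfun_bound_unit) auto
    then show ?thesis using \<open>0 < e\<close> by simp
  qed
  then show "\<exists>N. \<forall>n\<ge>N. norm ((strip h n o\<^sub>L T) - T) < e" by blast
qed

text \<open>
  For \<open>g = T (1 - P\<^sub>n) f\<close> with \<open>f\<close> in the unit ball, \<open>\<parallel>g\<parallel>\<^sup>2\<close> is up to a small error the inner product of
  \<open>g\<close> with one of finitely many net points \<open>k\<close>. The functional \<open>f \<mapsto> \<langle>T f, k\<rangle>\<close> is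
  represented by a vector \<open>v k\<close>, so this inner product is at most \<open>\<parallel>(1 - P\<^sub>n) (v k)\<parallel>\<close>, and
  \<open>(1 - P\<^sub>n) (v k)\<close> tends to zero.
\<close>

lemma compact_right_supported:
  assumes "T \<in> compact_operators" shows "T \<in> right_supported h"
  unfolding right_supported_def mem_Collect_eq
proof (rule LIMSEQ_I)
  fix e :: real assume "0 < e"
  define c where "c = 2 * norm T + 1"
  have c: "1 \<le> c" by (simp add: c_def)
  define d where "d = e\<^sup>2 / (16 * c)"
  have d: "0 < d" using \<open>0 < e\<close> c by (simp add: d_def)
  obtain K where K: "finite K" "\<And>f. norm f \<le> 1 \<Longrightarrow> \<exists>g\<in>K. norm (blinfun_apply T f - g) < d"
    using compact_net[OF assms d] by blast
  have "\<exists>v. \<forall>f. inner (blinfun_apply T f) g = inner v f" for g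
  proof -
    have "bounded_linear (\<lambda>f. inner (blinfun_apply T f) g)"
      by (rule bounded_linear_compose[OF bounded_linear_inner_left blinfun.bounded_linear_right])
    then show ?thesis by (metis riesz_representation)
  qed
  then obtain v where v: "\<And>f g. inner (blinfun_apply T f) g = inner (v g) f" by metis
  have "eventually (\<lambda>n. \<forall>g\<in>K. norm (blinfun_apply (strip h n) (v g) - v g) < d) sequentially"
    by (rule eventually_ball_finite[OF K(1)])
      (use tendstoD[OF strip_tendsto d] in \<open>auto simp: dist_norm\<close>)
  then obtain N where N: "\<And>n g. n \<ge> N \<Longrightarrow> g \<in> K \<Longrightarrow> norm (blinfun_apply (strip h n) (v g) - v g) < d"
    by (auto simp: eventually_sequentially)
  have "norm ((T o\<^sub>L strip h n) - T) < e" if "n \<ge> N" for n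
  proof -
    have "norm (blinfun_apply ((T o\<^sub>L strip h n) - T) f) \<le> e / 2" if f: "norm f = 1" for f
    proof -
      \<comment> \<open>The factor \<open>1/2\<close> brings the vector back into the unit ball, where the net applies.\<close>
      let ?f = "(1/2) *\<^sub>R (blinfun_apply (strip h n) f - f)"
      let ?g = "blinfun_apply T ?f"
      have "norm (blinfun_apply (strip h n) f) \<le> 1"
        using norm_blinfun[of "strip h n" f] norm_strip_le[of h n] f by simp
      then have "norm ?f \<le> 1"
        using f norm_triangle_ineq4[of "blinfun_apply (strip h n) f" f] by simp
      then obtain g where g: "g \<in> K" "norm (?g - g) < d" using K(2) by blast
      have ng: "norm ?g \<le> norm T" using norm_blinfun_le[OF \<open>norm ?f \<le> 1\<close>, of T] by simp
      have "inner ?g g = inner (v g) ?f" by (rule v)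
      also have "\<dots> = (1/2) * inner (blinfun_apply (strip h n) (v g) - v g) f"
        by (simp add: inner_diff_left inner_diff_right inner_strip)
      also have "\<dots> \<le> (1/2) * (norm (blinfun_apply (strip h n) (v g) - v g) * norm f)"
        by (intro mult_left_mono norm_cauchy_schwarz) simp
      also have "\<dots> \<le> d" using N[OF \<open>n \<ge> N\<close> g(1)] d f by simp
      finally have 1: "inner ?g g \<le> d" .
      have "inner ?g (?g - g) \<le> norm ?g * norm (?g - g)" by (rule norm_cauchy_schwarz)
      also have "\<dots> \<le> norm T * d"
        using ng g(2) by (intro mult_mono) auto
      finally have 2: "inner ?g (?g - g) \<le> norm T * d" .
      have "(norm ?g)\<^sup>2 = inner ?g (?g - g) + inner ?g g"
        by (simp add: power2_norm_eq_inner inner_diff_right)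
      also have "\<dots> \<le> (norm T + 1) * d" using 1 2 by (simp add: algebra_simps)
      also have "\<dots> \<le> c * d" using d by (intro mult_right_mono) (auto simp: c_def)
      also have "\<dots> = (e / 4)\<^sup>2" using c by (simp add: d_def power2_eq_square)
      finally have "norm ?g \<le> e / 4"
        by (rule power2_le_imp_le) (use \<open>0 < e\<close> in simp)
      moreover have "blinfun_apply ((T o\<^sub>L strip h n) - T) f = 2 *\<^sub>R ?g"
        by (simp add: blinfun.diff_left blinfun.diff_right blinfun.scaleR_right)
      ultimately show ?thesis using \<open>0 < e\<close> by simp
    qed
    then have "norm ((T o\<^sub>L strip h n) - T) \<le> e / 2"
      using \<open>0 < e\<close> by (intro norm_blinfun_bound_unit) auto
    then show ?thesis using \<open>0 < e\<close> by simp
  qed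
  then show "\<exists>N. \<forall>n\<ge>N. norm ((T o\<^sub>L strip h n) - T) < e" by blast
qed
section \<open>Strip ideals and their multipliers\<close>

definition strip_ideal :: "('a \<Rightarrow> int) \<Rightarrow> 'a operator set" where
  "strip_ideal h = bounded_operators \<inter> left_supported h \<inter> right_supported h"

text \<open>
  An element \<open>T\<close> of the right-hand side is the limit of its compressions \<open>P\<^sub>n T P\<^sub>n\<close>. Their index
  starts at one because the projections in the set on the left do.
\<close>

lemma closure_strip_ideal:
  "closure {T \<in> bounded_operators. \<exists>n\<ge>1. strip h n o\<^sub>L T = T \<and> T o\<^sub>L strip h n = T} = strip_ideal h"
  (is "closure ?G = _")
proof
  have "closed (strip_ideal h)"
    unfolding closed_sequential_limits strip_ideal_def
    using closed_sequentially[OF closed_bounded_operators]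
    by (auto intro: left_supported_closed right_supported_closed)
  moreover have "?G \<subseteq> strip_ideal h"
    by (auto simp: strip_ideal_def intro: left_supportedI right_supportedI)
  ultimately show "closure ?G \<subseteq> strip_ideal h" by (simp add: closure_minimal)
next
  show "strip_ideal h \<subseteq> closure ?G"
  proof
    fix T assume "T \<in> strip_ideal h"
    then have T: "T \<in> bounded_operators" "(\<lambda>n. strip h n o\<^sub>L T) \<longlonglongrightarrow> T" "(\<lambda>n. T o\<^sub>L strip h n) \<longlonglongrightarrow> T"
      by (auto simp: strip_ideal_def left_supported_def right_supported_def)
    define X where "X n = strip h (Suc n) o\<^sub>L T o\<^sub>L strip h (Suc n)" for n
    have "X n \<in> ?G" for n
    proof -
      have "strip h (Suc n) o\<^sub>L X n = (strip h (Suc n) o\<^sub>L strip h (Suc n)) o\<^sub>L (T o\<^sub>L strip h (Suc n))"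
        "X n o\<^sub>L strip h (Suc n) = strip h (Suc n) o\<^sub>L (T o\<^sub>L (strip h (Suc n) o\<^sub>L strip h (Suc n)))"
        by (simp_all only: X_def compose_assoc)
      then have "strip h (Suc n) o\<^sub>L X n = X n" "X n o\<^sub>L strip h (Suc n) = X n"
        by (simp_all add: X_def strip_strip compose_assoc)
      moreover have "X n \<in> bounded_operators"
        unfolding X_def using T(1) by (intro bounded_operators_compose strip_bounded)
      ultimately show ?thesis by (auto intro!: exI[of _ "Suc n"])
    qed
    moreover have "X \<longlonglongrightarrow> T"
    proof (rule LIM_zero_cancel, rule Lim_null_comparison)
      have "norm (X n - T) \<le> norm ((T o\<^sub>L strip h (Suc n)) - T) + norm ((strip h (Suc n) o\<^sub>L T) - T)" for n
      proof -
        have "X n - T = (strip h (Suc n) o\<^sub>L ((T o\<^sub>L strip h (Suc n)) - T)) + ((strip h (Suc n) o\<^sub>L T) - T)"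
          by (simp add: X_def compose_simps)
        also have "norm \<dots> \<le> norm (strip h (Suc n) o\<^sub>L ((T o\<^sub>L strip h (Suc n)) - T)) + norm ((strip h (Suc n) o\<^sub>L T) - T)"
          by (rule norm_triangle_ineq)
        finally show ?thesis
          using norm_strip_compose(1)[of h "Suc n" "(T o\<^sub>L strip h (Suc n)) - T"] by linarith
      qed
      then show "\<forall>\<^sub>F n in sequentially. norm (X n - T)
          \<le> norm ((T o\<^sub>L strip h (Suc n)) - T) + norm ((strip h (Suc n) o\<^sub>L T) - T)" by simp
      have "(\<lambda>n. norm ((T o\<^sub>L strip h n) - T) + norm ((strip h n o\<^sub>L T) - T)) \<longlonglongrightarrow> 0 + 0"
        by (intro tendsto_add tendsto_norm_zero LIM_zero T)
      then show "(\<lambda>n. norm ((T o\<^sub>L strip h (Suc n)) - T) + norm ((strip h (Suc n) o\<^sub>L T) - T)) \<longlonglongrightarrow> 0"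
        using LIMSEQ_Suc by fastforce
    qed
    ultimately show "T \<in> closure ?G"
      unfolding closure_sequential by blast
  qed
qed

lemma strip_ideal_subset_bounded: "T \<in> strip_ideal h \<Longrightarrow> T \<in> bounded_operators"
  by (simp add: strip_ideal_def)

lemma strip_ideal_diff:
  "S \<in> strip_ideal h \<Longrightarrow> T \<in> strip_ideal h \<Longrightarrow> S - T \<in> strip_ideal h"
  by (simp add: strip_ideal_def bounded_operators_diff left_supported_diff right_supported_diff)

lemma strip_ideal_compose:
  "S \<in> strip_ideal h \<Longrightarrow> T \<in> strip_ideal h \<Longrightarrow> S o\<^sub>L T \<in> strip_ideal h"
  by (simp add: strip_ideal_def bounded_operators_compose left_supported_compose right_supported_compose)

lemma compact_in_strip_ideal: "T \<in> compact_operators \<Longrightarrow> T \<in> strip_ideal h"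
  by (simp add: strip_ideal_def compact_subset_bounded compact_left_supported compact_right_supported)

lemma mult_op_in_strip_ideal:
  assumes "bounded (range V)" "\<And>x. V x \<noteq> 0 \<Longrightarrow> \<bar>h x\<bar> \<le> int n"
  shows "mult_op V \<in> strip_ideal h"
proof -
  have "V x = 0" if "\<not> \<bar>h x\<bar> \<le> int n" for x
    using assms(2) that by blast
  then have "strip h n o\<^sub>L mult_op V = mult_op V" "mult_op V o\<^sub>L strip h n = mult_op V"
    by (auto intro!: blinfun_eqI ell2_eqI simp: coord_strip coord_mult_op[OF assms(1)])
  then show ?thesis
    by (auto simp: strip_ideal_def assms(1) bounded_operators_mult_op
        intro: left_supportedI right_supportedI)
qed

text \<open>
  \<open>S T\<close> is the limit of \<open>S P\<^sub>n P'\<^sub>n T\<close>, and \<open>P\<^sub>n P'\<^sub>n\<close> is the projection to a finite set.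
\<close>

lemma strip_ideal_product_compact:
  assumes "\<And>n. finite {x. \<bar>h x\<bar> \<le> int n \<and> \<bar>h' x\<bar> \<le> int n}"
    and "S \<in> strip_ideal h" "T \<in> strip_ideal h'"
  shows "S o\<^sub>L T \<in> compact_operators"
proof (rule compactI_approx)
  have S: "S \<in> bounded_operators" "(\<lambda>n. S o\<^sub>L strip h n) \<longlonglongrightarrow> S"
    using assms(2) by (auto simp: strip_ideal_def right_supported_def)
  have T: "T \<in> bounded_operators" "(\<lambda>n. strip h' n o\<^sub>L T) \<longlonglongrightarrow> T"
    using assms(3) by (auto simp: strip_ideal_def left_supported_def)
  show "S o\<^sub>L T \<in> bounded_operators" using S(1) T(1) by (rule bounded_operators_compose)
  define X where "X n = (S o\<^sub>L strip h n) o\<^sub>L (strip h' n o\<^sub>L T)" for n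
  have lim: "X \<longlonglongrightarrow> (S o\<^sub>L T)"
    unfolding X_def
    by (intro bounded_bilinear.tendsto[OF bounded_bilinear_blinfun_compose] S(2) T(2))
  have X_compact: "X n \<in> compact_operators" for n
  proof -
    let ?V = "\<lambda>x. if \<bar>h x\<bar> \<le> int n \<and> \<bar>h' x\<bar> \<le> int n then 1 else (0::complex)"
    have "strip h n o\<^sub>L strip h' n = mult_op ?V"
      by (intro blinfun_eqI ell2_eqI) (simp add: coord_strip coord_mult_op[OF bounded_indicator])
    moreover have "mult_op ?V \<in> compact_operators"
      by (rule compact_mult_op_finite_support[OF assms(1)[of n]]) auto
    moreover have "X n = S o\<^sub>L ((strip h n o\<^sub>L strip h' n) o\<^sub>L T)"
      by (simp add: X_def compose_assoc)
    ultimately show ?thesis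
      using S(1) T(1) by (simp add: compact_compose_left compact_compose_right)
  qed
  show "\<exists>U\<in>compact_operators. norm ((S o\<^sub>L T) - U) < e" if e: "0 < e" for e
  proof -
    obtain N where "norm (X N - (S o\<^sub>L T)) < e"
      using LIMSEQ_D[OF lim e] by blast
    then show ?thesis
      using X_compact[of N] by (auto simp: norm_minus_commute)
  qed
qed

text \<open>
  \<open>T\<close> maps functions supported in a strip to functions that are almost supported in a wider strip,
  and the dual condition holds as well. Projections alone suffice to test this, which makes the condition
  easier to verify than stability of the whole ideal under multiplication by \<open>T\<close>.
\<close>

definition strip_multiplier :: "('a \<Rightarrow> int) \<Rightarrow> 'a operator set" where
  "strip_multiplier h = {T \<in> bounded_operators. \<forall>n.
     T o\<^sub>L strip h n \<in> left_supported h \<and> strip h n o\<^sub>L T \<in> right_supported h}"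

lemma strip_multiplier_compose:
  assumes T: "T \<in> strip_multiplier h" and S: "S \<in> strip_ideal h"
  shows "T o\<^sub>L S \<in> strip_ideal h" "S o\<^sub>L T \<in> strip_ideal h"
proof -
  have "(T o\<^sub>L strip h n) o\<^sub>L S \<in> left_supported h" for n
    using T by (intro left_supported_compose[of "T o\<^sub>L strip h n"]) (simp add: strip_multiplier_def)
  moreover have "(\<lambda>n. (T o\<^sub>L strip h n) o\<^sub>L S) \<longlonglongrightarrow> (T o\<^sub>L S)"
    using tendsto_compose_left[of "\<lambda>n. strip h n o\<^sub>L S" S sequentially T] S
    by (simp add: compose_assoc strip_ideal_def left_supported_def)
  ultimately have "T o\<^sub>L S \<in> left_supported h" by (rule left_supported_closed)
  then show "T o\<^sub>L S \<in> strip_ideal h"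
    using T S unfolding strip_ideal_def strip_multiplier_def
    by (blast intro: bounded_operators_compose right_supported_compose)
  have "S o\<^sub>L (strip h n o\<^sub>L T) \<in> right_supported h" for n
    using T by (intro right_supported_compose[of "strip h n o\<^sub>L T"]) (simp add: strip_multiplier_def)
  moreover have "(\<lambda>n. S o\<^sub>L (strip h n o\<^sub>L T)) \<longlonglongrightarrow> (S o\<^sub>L T)"
    using tendsto_compose_right[of "\<lambda>n. S o\<^sub>L strip h n" S sequentially T] S
    by (simp add: compose_assoc strip_ideal_def right_supported_def)
  ultimately have "S o\<^sub>L T \<in> right_supported h" by (rule right_supported_closed)
  then show "S o\<^sub>L T \<in> strip_ideal h"
    using T S unfolding strip_ideal_def strip_multiplier_def
    by (blast intro: bounded_operators_compose left_supported_compose)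
qed

section \<open>Slowly varying cutoffs\<close>

text \<open>
  A trapezoid: \<open>1\<close> up to distance \<open>n\<close> from the origin, then linearly decreasing to \<open>0\<close> over a length of
  \<open>N + 1\<close>; the successor keeps the slope \<open>1 / (N + 1)\<close> finite for all \<open>N\<close>.
\<close>

definition ramp :: "nat \<Rightarrow> nat \<Rightarrow> int \<Rightarrow> real" where
  "ramp n N t = max 0 (min 1 ((real (n + Suc N) - \<bar>real_of_int t\<bar>) / real (Suc N)))"

lemma ramp_bounds: "0 \<le> ramp n N t" "ramp n N t \<le> 1"
  by (auto simp: ramp_def)

lemma ramp_eq_1: "\<bar>t\<bar> \<le> int n \<Longrightarrow> ramp n N t = 1"
  by (simp add: ramp_def min_def field_simps)

lemma ramp_eq_0: "\<bar>t\<bar> \<ge> int (n + Suc N) \<Longrightarrow> ramp n N t = 0"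
proof -
  assume "\<bar>t\<bar> \<ge> int (n + Suc N)"
  then have "real_of_int (int (n + Suc N)) \<le> real_of_int \<bar>t\<bar>" by (rule of_int_le_iff[THEN iffD2])
  then have "real (n + Suc N) - \<bar>real_of_int t\<bar> \<le> 0" by simp
  then have "(real (n + Suc N) - \<bar>real_of_int t\<bar>) / real (Suc N) \<le> 0"
    by (rule divide_nonpos_nonneg) simp
  then show "ramp n N t = 0" by (simp add: ramp_def)
qed

lemma ramp_lipschitz: "\<bar>ramp n N s - ramp n N t\<bar> \<le> \<bar>real_of_int (s - t)\<bar> / real (Suc N)"
proof -
  have clamp: "\<bar>max 0 (min 1 a) - max 0 (min 1 b)\<bar> \<le> \<bar>a - b\<bar>" for a b :: real
    by (auto simp: max_def min_def abs_if)
  have "\<bar>ramp n N s - ramp n N t\<bar> \<le> \<bar>(real (n + Suc N) - \<bar>real_of_int s\<bar>) / real (Suc N)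
      - (real (n + Suc N) - \<bar>real_of_int t\<bar>) / real (Suc N)\<bar>"
    unfolding ramp_def by (rule clamp)
  also have "\<dots> = \<bar>\<bar>real_of_int t\<bar> - \<bar>real_of_int s\<bar>\<bar> / real (Suc N)"
    by (simp add: diff_divide_distrib[symmetric] abs_divide)
  also have "\<dots> \<le> \<bar>real_of_int (s - t)\<bar> / real (Suc N)"
    by (intro divide_right_mono) auto
  finally show ?thesis .
qed

definition cutoff :: "('a \<Rightarrow> int) \<Rightarrow> nat \<Rightarrow> nat \<Rightarrow> 'a operator" where
  "cutoff h n N = mult_op (\<lambda>x. complex_of_real (ramp n N (h x)))"

lemma bounded_ramp: "bounded (range (\<lambda>x. complex_of_real (ramp n N (h x))))"
  by (rule bounded_range_if_norm_le[of _ 1]) (simp add: ramp_bounds)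

lemma coord_cutoff: "coord (blinfun_apply (cutoff h n N) f) x = of_real (ramp n N (h x)) * coord f x"
  by (simp add: cutoff_def coord_mult_op[OF bounded_ramp])

lemma cutoff_bounded: "cutoff h n N \<in> bounded_operators"
  unfolding cutoff_def by (intro bounded_operators_mult_op bounded_ramp)

lemma cutoff_strip:
  "cutoff h n N o\<^sub>L strip h n = strip h n" "strip h n o\<^sub>L cutoff h n N = strip h n"
  by (auto intro!: blinfun_eqI ell2_eqI simp: coord_cutoff coord_strip ramp_eq_1)

lemma cutoff_left_supported: "cutoff h n N \<in> left_supported h"
  by (rule left_supportedI[of h "n + Suc N"])
    (auto intro!: blinfun_eqI ell2_eqI simp: coord_cutoff coord_strip ramp_eq_0)

lemma cutoff_right_supported: "cutoff h n N \<in> right_supported h"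
  by (rule right_supportedI[of _ h "n + Suc N"])
    (auto intro!: blinfun_eqI ell2_eqI simp: coord_cutoff coord_strip ramp_eq_0)

text \<open>
  The flat cutoffs act as an approximate unit of the strip ideal, and these operators commute with it
  asymptotically. The condition is imposed for every inner width \<open>n\<close>, since a
  cutoff equal to \<open>1\<close> on any prescribed strip is needed.
\<close>

definition slowly_commuting :: "('a \<Rightarrow> int) \<Rightarrow> 'a operator set" where
  "slowly_commuting h = {T. \<forall>n. (\<lambda>N. (cutoff h n N o\<^sub>L T) - (T o\<^sub>L cutoff h n N)) \<longlonglongrightarrow> 0}"

lemma slowly_commuting_add:
  assumes "S \<in> slowly_commuting h" "T \<in> slowly_commuting h"
  shows "S + T \<in> slowly_commuting h"
  unfolding slowly_commuting_def mem_Collect_eq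
proof
  fix n
  have "(\<lambda>N. ((cutoff h n N o\<^sub>L S) - (S o\<^sub>L cutoff h n N)) + ((cutoff h n N o\<^sub>L T) - (T o\<^sub>L cutoff h n N))) \<longlonglongrightarrow> 0 + 0"
    using assms by (intro tendsto_add) (auto simp: slowly_commuting_def)
  then show "(\<lambda>N. (cutoff h n N o\<^sub>L (S + T)) - ((S + T) o\<^sub>L cutoff h n N)) \<longlonglongrightarrow> 0"
    by (simp add: compose_simps algebra_simps)
qed

text \<open>
  The commutator is a derivation: \<open>[\<phi>, S T] = [\<phi>, S] T + S [\<phi>, T]\<close>.
\<close>

lemma slowly_commuting_compose:
  assumes "S \<in> slowly_commuting h" "T \<in> slowly_commuting h"
  shows "S o\<^sub>L T \<in> slowly_commuting h"
  unfolding slowly_commuting_def mem_Collect_eq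
proof
  fix n
  let ?c = "\<lambda>N. cutoff h n N"
  have "(\<lambda>N. (((?c N o\<^sub>L S) - (S o\<^sub>L ?c N)) o\<^sub>L T) + (S o\<^sub>L ((?c N o\<^sub>L T) - (T o\<^sub>L ?c N)))) \<longlonglongrightarrow> (0 o\<^sub>L T) + (S o\<^sub>L 0)"
    using assms by (intro tendsto_add tendsto_compose_left tendsto_compose_right)
      (auto simp: slowly_commuting_def)
  then show "(\<lambda>N. (?c N o\<^sub>L (S o\<^sub>L T)) - ((S o\<^sub>L T) o\<^sub>L ?c N)) \<longlonglongrightarrow> 0"
    by (simp add: compose_simps)
qed

lemma slowly_commuting_mult_op: "bounded (range V) \<Longrightarrow> mult_op V \<in> slowly_commuting h"
proof -
  assume "bounded (range V)"
  then have "cutoff h n N o\<^sub>L mult_op V = mult_op V o\<^sub>L cutoff h n N" for n N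
    by (intro blinfun_eqI ell2_eqI) (simp add: coord_cutoff coord_mult_op)
  then show ?thesis by (simp add: slowly_commuting_def)
qed

lemma slowly_commuting_zero: "0 \<in> slowly_commuting h"
  by (simp add: slowly_commuting_def)

text \<open>
  The commutator is the translation multiplied by the difference of two values of the cutoff at points
  whose \<open>h\<close>-distance is \<open>\<bar>h b\<bar>\<close>, hence small by the Lipschitz bound.
\<close>

lemma slowly_commuting_translation:
  assumes add: "\<And>x y. h (x + y) = h x + h y"
  shows "translation b \<in> slowly_commuting h"
  unfolding slowly_commuting_def mem_Collect_eq
proof (rule allI, rule Lim_null_comparison)
  fix n
  let ?c = "real_of_int \<bar>h b\<bar>"
  show "\<forall>\<^sub>F N in sequentially. norm ((cutoff h n N o\<^sub>L translation b) - (translation b o\<^sub>L cutoff h n N))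
      \<le> ?c * inverse (real (Suc N))"
  proof (intro always_eventually allI norm_blinfun_bound)
    fix N f
    have "norm (blinfun_apply ((cutoff h n N o\<^sub>L translation b) - (translation b o\<^sub>L cutoff h n N)) f)
        \<le> ?c * inverse (real (Suc N)) * norm (blinfun_apply (translation b) f)"
    proof (rule norm_ell2_le_mult)
      fix x
      have "cmod (of_real (ramp n N (h x)) - of_real (ramp n N (h (x + b)))) \<le> ?c * inverse (real (Suc N))"
        using ramp_lipschitz[of n N "h x" "h (x + b)"]
        by (simp add: add divide_inverse flip: of_real_diff)
      then show "cmod (coord (blinfun_apply ((cutoff h n N o\<^sub>L translation b) - (translation b o\<^sub>L cutoff h n N)) f) x)
          \<le> ?c * inverse (real (Suc N)) * cmod (coord (blinfun_apply (translation b) f) x)"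
        by (simp add: blinfun.diff_left minus_ell2.rep_eq coord_cutoff coord_translation norm_mult
            mult_right_mono flip: left_diff_distrib)
    qed simp
    then show "norm (blinfun_apply ((cutoff h n N o\<^sub>L translation b) - (translation b o\<^sub>L cutoff h n N)) f)
        \<le> ?c * inverse (real (Suc N)) * norm f" by simp
  qed simp
  show "(\<lambda>N. ?c * inverse (real (Suc N))) \<longlonglongrightarrow> 0"
    using tendsto_mult_right_zero[OF LIMSEQ_inverse_real_of_nat] by simp
qed

text \<open>
  With \<open>\<phi> = 1\<close> on the strip of \<open>P\<close>, the operator \<open>T P = T \<phi> P\<close> differs from \<open>\<phi> T P\<close> by a
  commutator, and \<open>\<phi>\<close> is supported in a wider strip.
\<close>

lemma slowly_commuting_strip_multiplier:
  assumes T: "T \<in> slowly_commuting h" "T \<in> bounded_operators"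
  shows "T \<in> strip_multiplier h"
  unfolding strip_multiplier_def mem_Collect_eq
proof (intro conjI allI T(2))
  fix n
  let ?c = "\<lambda>N. cutoff h n N" and ?P = "strip h n"
  let ?K = "\<lambda>N. (?c N o\<^sub>L T) - (T o\<^sub>L ?c N)"
  have lim: "?K \<longlonglongrightarrow> 0" using T(1) by (simp add: slowly_commuting_def)
  show "T o\<^sub>L ?P \<in> left_supported h"
  proof (rule left_supported_closed)
    show "?c N o\<^sub>L (T o\<^sub>L ?P) \<in> left_supported h" for N
      by (intro left_supported_compose cutoff_left_supported)
    have "(\<lambda>N. (T o\<^sub>L ?P) + (?K N o\<^sub>L ?P)) \<longlonglongrightarrow> ((T o\<^sub>L ?P) + (0 o\<^sub>L ?P))"
      by (intro tendsto_add tendsto_const tendsto_compose_right lim)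
    then show "(\<lambda>N. ?c N o\<^sub>L (T o\<^sub>L ?P)) \<longlonglongrightarrow> (T o\<^sub>L ?P)"
      by (simp add: compose_simps cutoff_strip)
  qed
  show "?P o\<^sub>L T \<in> right_supported h"
  proof (rule right_supported_closed)
    show "(?P o\<^sub>L T) o\<^sub>L ?c N \<in> right_supported h" for N
      by (intro right_supported_compose cutoff_right_supported)
    have "(\<lambda>N. (?P o\<^sub>L T) - (?P o\<^sub>L ?K N)) \<longlonglongrightarrow> ((?P o\<^sub>L T) - (?P o\<^sub>L 0))"
      by (intro tendsto_diff tendsto_const tendsto_compose_left lim)
    then show "(\<lambda>N. (?P o\<^sub>L T) o\<^sub>L ?c N) \<longlonglongrightarrow> (?P o\<^sub>L T)"
      by (simp add: compose_simps cutoff_strip flip: compose_assoc[of ?P "?c _" T])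
  qed
qed

text \<open>
  This replaces the invariance of the spectrum under passage to a \<open>C\<close>*-subalgebra. With
  \<open>k = x y - 1\<close> and \<open>k' = y x - 1\<close>, expanding \<open>y (\<phi> x - x \<phi>) y\<close> gives
  \<open>y \<phi> = \<phi> y + y [\<phi>, x] y - y \<phi> k + k' \<phi> y\<close>. The commutator term tends to zero, the terms with \<open>k\<close>
  and \<open>k'\<close> are compact, and \<open>\<phi> y\<close> is supported in a strip. Multiplication by \<open>P\<close>, for which
  \<open>\<phi> P = P\<close>, turns this into a statement on \<open>y P\<close>; solving for \<open>\<phi> y\<close> instead gives \<open>P y\<close>.
\<close>

lemma parametrix_strip_multiplier:
  assumes x: "x \<in> slowly_commuting h" and y: "y \<in> bounded_operators"
    and "(x o\<^sub>L y) - id_blinfun \<in> compact_operators"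
    and "(y o\<^sub>L x) - id_blinfun \<in> compact_operators"
  shows "y \<in> strip_multiplier h"
  unfolding strip_multiplier_def mem_Collect_eq
proof (intro conjI allI y)
  fix n
  define k where "k = (x o\<^sub>L y) - id_blinfun"
  define k' where "k' = (y o\<^sub>L x) - id_blinfun"
  let ?c = "\<lambda>N. cutoff h n N" and ?P = "strip h n"
  let ?K = "\<lambda>N. (?c N o\<^sub>L x) - (x o\<^sub>L ?c N)"
  have lim: "?K \<longlonglongrightarrow> 0" using x by (simp add: slowly_commuting_def)
  have eq: "(y o\<^sub>L ?c N) - (?c N o\<^sub>L y) = (y o\<^sub>L (?K N o\<^sub>L y)) - (y o\<^sub>L (?c N o\<^sub>L k)) + (k' o\<^sub>L (?c N o\<^sub>L y))" for N
    by (simp add: k_def k'_def compose_simps)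
  have cpt: "y o\<^sub>L (?c N o\<^sub>L k) \<in> compact_operators" "k' o\<^sub>L (?c N o\<^sub>L y) \<in> compact_operators" for N
    using assms cutoff_bounded[of h n N] unfolding k_def k'_def
    by (auto intro: compact_compose_left compact_compose_right bounded_operators_compose)
  show "y o\<^sub>L ?P \<in> left_supported h"
  proof (rule left_supported_closed)
    show "((?c N o\<^sub>L y) - (y o\<^sub>L (?c N o\<^sub>L k)) + (k' o\<^sub>L (?c N o\<^sub>L y))) o\<^sub>L ?P \<in> left_supported h" for N
      by (intro left_supported_compose left_supported_add left_supported_diff cutoff_left_supported
          compact_left_supported cpt)
    have "(\<lambda>N. (y o\<^sub>L ?P) - ((y o\<^sub>L (?K N o\<^sub>L y)) o\<^sub>L ?P)) \<longlonglongrightarrow> (y o\<^sub>L ?P) - ((y o\<^sub>L (0 o\<^sub>L y)) o\<^sub>L ?P)"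
      by (intro tendsto_diff tendsto_const tendsto_compose_left tendsto_compose_right lim)
    moreover have "((?c N o\<^sub>L y) - (y o\<^sub>L (?c N o\<^sub>L k)) + (k' o\<^sub>L (?c N o\<^sub>L y))) o\<^sub>L ?P
        = (y o\<^sub>L ?P) - ((y o\<^sub>L (?K N o\<^sub>L y)) o\<^sub>L ?P)" for N
    proof -
      have "(?c N o\<^sub>L y) - (y o\<^sub>L (?c N o\<^sub>L k)) + (k' o\<^sub>L (?c N o\<^sub>L y)) = (y o\<^sub>L ?c N) - (y o\<^sub>L (?K N o\<^sub>L y))"
        using eq[of N] by (simp add: algebra_simps)
      then show ?thesis by (simp only: compose_diff_left compose_assoc cutoff_strip)
    qed
    ultimately show "(\<lambda>N. ((?c N o\<^sub>L y) - (y o\<^sub>L (?c N o\<^sub>L k)) + (k' o\<^sub>L (?c N o\<^sub>L y))) o\<^sub>L ?P) \<longlonglongrightarrow> (y o\<^sub>L ?P)"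
      by simp
  qed
  show "?P o\<^sub>L y \<in> right_supported h"
  proof (rule right_supported_closed)
    show "?P o\<^sub>L ((y o\<^sub>L ?c N) + (y o\<^sub>L (?c N o\<^sub>L k)) - (k' o\<^sub>L (?c N o\<^sub>L y))) \<in> right_supported h" for N
      by (intro right_supported_compose right_supported_add right_supported_diff
          cutoff_right_supported compact_right_supported cpt)
    have "(\<lambda>N. (?P o\<^sub>L y) + (?P o\<^sub>L (y o\<^sub>L (?K N o\<^sub>L y)))) \<longlonglongrightarrow> ((?P o\<^sub>L y) + (?P o\<^sub>L (y o\<^sub>L (0 o\<^sub>L y))))"
      by (intro tendsto_add tendsto_const tendsto_compose_left tendsto_compose_right lim)
    moreover have "?P o\<^sub>L ((y o\<^sub>L ?c N) + (y o\<^sub>L (?c N o\<^sub>L k)) - (k' o\<^sub>L (?c N o\<^sub>L y)))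
        = (?P o\<^sub>L y) + (?P o\<^sub>L (y o\<^sub>L (?K N o\<^sub>L y)))" for N
    proof -
      have "(y o\<^sub>L ?c N) + (y o\<^sub>L (?c N o\<^sub>L k)) - (k' o\<^sub>L (?c N o\<^sub>L y)) = (?c N o\<^sub>L y) + (y o\<^sub>L (?K N o\<^sub>L y))"
        using eq[of N] by (simp add: algebra_simps)
      then show ?thesis
        by (simp only: compose_add_right compose_assoc[symmetric] cutoff_strip)
    qed
    ultimately show "(\<lambda>N. ?P o\<^sub>L ((y o\<^sub>L ?c N) + (y o\<^sub>L (?c N o\<^sub>L k)) - (k' o\<^sub>L (?c N o\<^sub>L y)))) \<longlonglongrightarrow> (?P o\<^sub>L y)"
      by simp
  qed
qed
section \<open>Translation-invariant operators\<close>

text \<open>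
  The translate of \<open>f\<close> sees in the strip of width \<open>m\<close> only values of \<open>f\<close> at points with \<open>h > r\<close>.
\<close>

lemma norm_strip_translation_le:
  assumes add: "\<And>x y. h (x + y) = h x + h y" and "int m + int r < h b"
  shows "norm (blinfun_apply (strip h m) (blinfun_apply (translation b) f))
    \<le> norm (f - blinfun_apply (strip h r) f)"
proof -
  have "norm (blinfun_apply (strip h m) (blinfun_apply (translation b) f))
      \<le> 1 * norm (blinfun_apply (translation b) (f - blinfun_apply (strip h r) f))"
    by (rule norm_ell2_le_mult)
      (use assms in \<open>auto simp: coord_strip coord_translation minus_ell2.rep_eq\<close>)
  then show ?thesis by simp
qed

lemma translation_zero: "translation 0 = id_blinfun"
  by (rule blinfun_eqI, rule ell2_eqI) (simp add: coord_translation)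

lemma commute_translation_multiple:
  assumes "T o\<^sub>L translation e = translation e o\<^sub>L T"
  shows "T o\<^sub>L translation (((+) e ^^ n) 0) = translation (((+) e ^^ n) 0) o\<^sub>L T"
proof (induction n)
  case 0
  show ?case by (simp add: translation_zero)
next
  case (Suc n)
  let ?s = "((+) e ^^ n) 0"
  have "T o\<^sub>L translation (((+) e ^^ Suc n) 0) = (T o\<^sub>L translation e) o\<^sub>L translation ?s"
    by (simp add: translation_add compose_assoc)
  also have "\<dots> = translation e o\<^sub>L (T o\<^sub>L translation ?s)"
    by (simp only: assms compose_assoc)
  also have "\<dots> = translation (((+) e ^^ Suc n) 0) o\<^sub>L T"
    by (simp add: Suc translation_add compose_assoc)
  finally show ?case .
qed

text \<open>
  Translation by multiples of \<open>e\<close> moves every vector out of all strips, so that the errors \<open>x y - 1\<close> and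
  \<open>y x - 1\<close>, conjugated by these translations, converge strongly to zero while \<open>x\<close> does not change. The
  first makes the range of \<open>x\<close> dense, the second bounds \<open>x\<close> from below.
\<close>

lemma invertible_if_invertible_modulo_strip:
  assumes add: "\<And>x y. h (x + y) = h x + h y" and e: "1 \<le> h e"
    and comm: "x o\<^sub>L translation e = translation e o\<^sub>L x"
    and x: "x \<in> bounded_operators"
    and xy: "(x o\<^sub>L y) - id_blinfun \<in> right_supported h"
    and yx: "(y o\<^sub>L x) - id_blinfun \<in> right_supported h"
  shows "\<exists>z\<in>bounded_operators. x o\<^sub>L z = id_blinfun \<and> z o\<^sub>L x = id_blinfun"
proof -
  define s where "s n = ((+) e ^^ n) 0" for n :: nat
  have s_Suc: "s (Suc n) = e + s n" for n by (simp add: s_def)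
  have h_zero: "h 0 = 0" using add[of 0 0] by simp
  have h_s: "int n \<le> h (s n)" for n
    using e by (induction n) (auto simp: s_Suc add, simp add: s_def h_zero)
  let ?t = "\<lambda>n f. blinfun_apply (translation (s n)) f"
  let ?t' = "\<lambda>n f. blinfun_apply (translation (- s n)) f"
  let ?x = "blinfun_apply x" and ?y = "blinfun_apply y"
  have "x o\<^sub>L translation (s n) = translation (s n) o\<^sub>L x" for n
    unfolding s_def using comm by (rule commute_translation_multiple)
  then have comm_t: "?x (?t n f) = ?t n (?x f)" for n f
    by (metis blinfun_apply_blinfun_compose)
  have comm_t': "?x (?t' n f) = ?t' n (?x f)" for n f
    using comm_t[of n "?t' n f"] translation_inverse[of "s n" f]
      translation_inverse[of "- s n" "?x (?t' n f)"] by simp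
  have vanish: "(\<lambda>n. blinfun_apply j (?t n f)) \<longlonglongrightarrow> 0" if j: "j \<in> right_supported h" for j f
  proof (rule LIMSEQ_I)
    fix d :: real assume "0 < d"
    \<comment> \<open>The error splits into a part proportional to \<open>norm f\<close> and one proportional to \<open>norm j\<close>;
      \<open>c\<close> dominates both.\<close>
    define c where "c = norm f + norm j + 1"
    have c: "0 < c" by (simp add: c_def add_nonneg_pos)
    define d' where "d' = d / (2 * c)"
    have d': "0 < d'" using \<open>0 < d\<close> c by (simp add: d'_def)
    obtain m where m: "norm ((j o\<^sub>L strip h m) - j) < d'"
      using LIMSEQ_D[of "\<lambda>m. j o\<^sub>L strip h m", OF _ d'] j by (auto simp: right_supported_def)
    obtain r where r: "norm (blinfun_apply (strip h r) f - f) < d'"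
      using LIMSEQ_D[OF strip_tendsto d'] by blast
    have "norm (blinfun_apply j (?t n f) - 0) < d" if n: "n \<ge> m + r + 1" for n
    proof -
      have "int m + int r < h (s n)" using h_s[of n] n by linarith
      from norm_strip_translation_le[OF add this, of f]
      have "norm (blinfun_apply (strip h m) (?t n f)) \<le> d'"
        using r by (simp add: norm_minus_commute)
      then have 1: "norm (blinfun_apply j (blinfun_apply (strip h m) (?t n f))) \<le> norm j * d'"
        by (rule norm_blinfun_le)
      have "norm (blinfun_apply ((j o\<^sub>L strip h m) - j) (?t n f)) \<le> d' * norm f"
        using norm_blinfun[of "(j o\<^sub>L strip h m) - j" "?t n f"] m
        by (smt (verit) mult_right_mono norm_ge_zero norm_translation)
      moreover have "blinfun_apply j (?t n f) = blinfun_apply j (blinfun_apply (strip h m) (?t n f))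
          - blinfun_apply ((j o\<^sub>L strip h m) - j) (?t n f)"
        by (simp add: blinfun.diff_left)
      ultimately have "norm (blinfun_apply j (?t n f)) \<le> norm j * d' + d' * norm f"
        using 1 norm_triangle_ineq4[of "blinfun_apply j (blinfun_apply (strip h m) (?t n f))"
            "blinfun_apply ((j o\<^sub>L strip h m) - j) (?t n f)"] by simp
      also have "\<dots> \<le> d' * c" using d' by (simp add: c_def algebra_simps)
      also have "\<dots> = d / 2"
        using c by (simp add: d'_def)
      finally show ?thesis using \<open>0 < d\<close> by simp
    qed
    then show "\<exists>N. \<forall>n\<ge>N. norm (blinfun_apply j (?t n f) - 0) < d" by blast
  qed
  \<comment> \<open>Translations are isometries, so the bound can be read off along the translates of \<open>f\<close>.\<close>
  have below: "norm f \<le> norm y * norm (?x f)" for f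
  proof (rule LIMSEQ_le_const2)
    let ?j = "(y o\<^sub>L x) - id_blinfun"
    have "norm f - norm (blinfun_apply ?j (?t n f)) \<le> norm y * norm (?x f)" for n
    proof -
      have "?t n f = ?y (?t n (?x f)) - blinfun_apply ?j (?t n f)"
        by (simp add: blinfun.diff_left comm_t)
      then have "norm f \<le> norm (?y (?t n (?x f))) + norm (blinfun_apply ?j (?t n f))"
        by (metis norm_translation norm_triangle_ineq4)
      then show ?thesis using norm_blinfun[of y "?t n (?x f)"] by simp
    qed
    then show "\<exists>N. \<forall>n\<ge>N. norm f - norm (blinfun_apply ?j (?t n f)) \<le> norm y * norm (?x f)"
      by blast
    have "(\<lambda>n. norm f - norm (blinfun_apply ?j (?t n f))) \<longlonglongrightarrow> norm f - 0"
      by (intro tendsto_diff tendsto_const tendsto_norm_zero vanish yx)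
    then show "(\<lambda>n. norm f - norm (blinfun_apply ?j (?t n f))) \<longlonglongrightarrow> norm f" by simp
  qed
  have "closed (range ?x)"
  proof -
    have "complete (range ?x)"
    proof (rule complete_isometric_image)
      show "0 < 1 / (norm y + 1)" by (simp add: add_nonneg_pos)
      show "\<forall>f\<in>UNIV. 1 / (norm y + 1) * norm f \<le> norm (?x f)"
      proof
        fix f
        have "norm f \<le> (norm y + 1) * norm (?x f)"
          using below[of f] by (simp add: distrib_right add_increasing2)
        then show "1 / (norm y + 1) * norm f \<le> norm (?x f)"
          by (simp add: pos_divide_le_eq add_nonneg_pos mult.commute)
      qed
    qed (auto simp: blinfun.bounded_linear_right complete_UNIV)
    then show ?thesis by (rule complete_imp_closed)
  qed
  have "g \<in> range ?x" for g
  proof (rule closed_sequentially[OF \<open>closed (range ?x)\<close>])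
    \<comment> \<open>The conjugates of \<open>y\<close> provide approximate preimages of \<open>g\<close>.\<close>
    let ?j = "(x o\<^sub>L y) - id_blinfun"
    show "?x (?t' n (?y (?t n g))) \<in> range ?x" for n by simp
    have "?x (?t' n (?y (?t n g))) = g + ?t' n (blinfun_apply ?j (?t n g))" for n
      using translation_inverse[of "- s n" g]
      by (simp add: comm_t' blinfun.diff_left blinfun.diff_right)
    moreover have "(\<lambda>n. ?t' n (blinfun_apply ?j (?t n g))) \<longlonglongrightarrow> 0"
      by (rule tendsto_norm_zero_cancel) (use tendsto_norm_zero[OF vanish[OF xy]] in simp)
    then have "(\<lambda>n. g + ?t' n (blinfun_apply ?j (?t n g))) \<longlonglongrightarrow> g + 0"
      by (intro tendsto_add tendsto_const)
    ultimately show "(\<lambda>n. ?x (?t' n (?y (?t n g)))) \<longlonglongrightarrow> g" by simp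
  qed
  then have z: "?x (inv_into UNIV ?x g) = g" for g by (rule f_inv_into_f)
  define z where "z = inv_into UNIV ?x"
  note z = z[folded z_def]
  have inj: "f = g" if "?x f = ?x g" for f g
    using below[of "f - g"] that by (simp add: blinfun.diff_right)
  have "bounded_linear z"
  proof (rule bounded_linear_intro)
    show "norm (z g) \<le> norm g * norm y" for g
      using below[of "z g"] by (simp add: z mult.commute)
  qed (rule inj, simp add: z blinfun.add_right blinfun.scaleR_right)+
  then have Z: "blinfun_apply (Blinfun z) = z" by (rule bounded_linear_Blinfun_apply)
  show ?thesis
  proof (intro bexI conjI)
    show "x o\<^sub>L Blinfun z = id_blinfun"
      by (rule blinfun_eqI) (simp add: Z z)
    show "Blinfun z o\<^sub>L x = id_blinfun"
      by (rule blinfun_eqI, rule inj) (simp add: Z z)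
    have "z (scaleC_ell2 c f) = scaleC_ell2 c (z f)" for c f
      by (rule inj) (simp add: z bounded_operatorsD[OF x])
    then show "Blinfun z \<in> bounded_operators"
      by (simp add: bounded_operators_def Z)
  qed
qed

section \<open>Spectra in quotients of operator algebras\<close>

lemma (in ideal) Units_Quot_iff:
  assumes x: "x \<in> carrier R"
  shows "I +> x \<in> Units (R Quot I) \<longleftrightarrow>
    (\<exists>y\<in>carrier R. x \<otimes> y \<ominus> \<one> \<in> I \<and> y \<otimes> x \<ominus> \<one> \<in> I)"
proof -
  have carrier: "carrier (R Quot I) = (\<lambda>y. I +> y) ` carrier R"
    unfolding FactRing_def A_RCOSETS_def' by auto
  have mult: "(I +> y) \<otimes>\<^bsub>R Quot I\<^esub> (I +> z) = \<one>\<^bsub>R Quot I\<^esub> \<longleftrightarrow> y \<otimes> z \<ominus> \<one> \<in> I"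
    if "y \<in> carrier R" "z \<in> carrier R" for y z
    using that quotient_eq_iff_same_a_r_cos[OF ideal_axioms m_closed[OF that] one_closed]
    by (simp add: FactRing_def rcoset_mult_add)
  have "I +> x \<in> Units (R Quot I) \<longleftrightarrow> (\<exists>y\<in>carrier R.
      (I +> y) \<otimes>\<^bsub>R Quot I\<^esub> (I +> x) = \<one>\<^bsub>R Quot I\<^esub> \<and> (I +> x) \<otimes>\<^bsub>R Quot I\<^esub> (I +> y) = \<one>\<^bsub>R Quot I\<^esub>)"
    unfolding Units_def carrier using x by blast
  then show ?thesis using x by (auto simp: mult)
qed

lemma (in ideal) minus_Quot:
  assumes "x \<in> carrier R" "y \<in> carrier R"
  shows "(I +> x) \<ominus>\<^bsub>R Quot I\<^esub> (I +> y) = I +> (x \<ominus> y)"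
proof -
  interpret H: ring_hom_ring R "R Quot I" "(+>) I" by (rule rcos_ring_hom_ring)
  show ?thesis
    using assms by (simp add: a_minus_def)
qed

text \<open>
  These are the closure properties that the ring structure and the map \<open>c \<mapsto> c 1\<close> need; the unit, sums
  and negatives are obtained from them.
\<close>

locale operator_algebra =
  fixes S :: "'a operator set"
  assumes zero: "0 \<in> S" and scalar: "scalar_op c \<in> S"
    and diff: "x \<in> S \<Longrightarrow> y \<in> S \<Longrightarrow> x - y \<in> S"
    and compose: "x \<in> S \<Longrightarrow> y \<in> S \<Longrightarrow> x o\<^sub>L y \<in> S"
begin

lemma one: "id_blinfun \<in> S"
proof -
  have "scalar_op 1 = (id_blinfun :: 'a operator)"
    by (rule blinfun_eqI, rule ell2_eqI) (simp add: scalar_op_apply scaleC_ell2.rep_eq)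
  then show ?thesis using scalar[of 1] by simp
qed

lemma uminus: "x \<in> S \<Longrightarrow> - x \<in> S"
  using diff[OF zero] by simp

lemma add: "x \<in> S \<Longrightarrow> y \<in> S \<Longrightarrow> x + y \<in> S"
  using diff[of x "- y"] uminus[of y] by simp

lemma ring_operator_ring: "ring (operator_ring S)"
proof (rule ringI)
  show "abelian_group (operator_ring S)"
  proof (rule abelian_groupI)
    fix x assume "x \<in> carrier (operator_ring S)"
    then show "\<exists>y\<in>carrier (operator_ring S). y \<oplus>\<^bsub>operator_ring S\<^esub> x = \<zero>\<^bsub>operator_ring S\<^esub>"
      by (intro bexI[of _ "- x"]) (simp_all add: operator_ring_def uminus)
  qed (simp_all add: operator_ring_def zero add ac_simps)
  show "Group.monoid (operator_ring S)"
    by (rule monoidI) (auto simp: operator_ring_def one compose compose_assoc)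
qed (auto simp: operator_ring_def compose_add_left compose_add_right)

lemma minus_operator_ring:
  assumes "x \<in> S" "y \<in> S"
  shows "x \<ominus>\<^bsub>operator_ring S\<^esub> y = x - y"
proof -
  interpret R: ring "operator_ring S" by (rule ring_operator_ring)
  have "\<ominus>\<^bsub>operator_ring S\<^esub> y = - y"
    by (rule R.minus_equality) (use assms(2) uminus in \<open>auto simp: operator_ring_def\<close>)
  then show ?thesis by (simp add: a_minus_def operator_ring_def)
qed

lemma spectrum_operator_ring:
  assumes "T \<in> S"
  shows "algebra_spectrum (operator_ring S) scalar_op T =
    {c. \<not> (\<exists>y\<in>S. (T - scalar_op c) o\<^sub>L y = id_blinfun \<and> y o\<^sub>L (T - scalar_op c) = id_blinfun)}"
proof -
  have "T \<ominus>\<^bsub>operator_ring S\<^esub> scalar_op c = T - scalar_op c" for c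
    using assms scalar by (rule minus_operator_ring)
  moreover have "T - scalar_op c \<in> S" for c using assms scalar by (rule diff)
  then have "T - scalar_op c \<in> Units (operator_ring S) \<longleftrightarrow>
      (\<exists>y\<in>S. (T - scalar_op c) o\<^sub>L y = id_blinfun \<and> y o\<^sub>L (T - scalar_op c) = id_blinfun)" for c
    unfolding Units_def by (auto simp: operator_ring_def)
  ultimately show ?thesis by (simp add: algebra_spectrum_def)
qed

end

locale operator_ideal = operator_algebra +
  fixes J :: "'a operator set"
  assumes ideal_subset: "J \<subseteq> S" and ideal_zero: "0 \<in> J"
    and ideal_diff: "x \<in> J \<Longrightarrow> y \<in> J \<Longrightarrow> x - y \<in> J"
    and ideal_left: "x \<in> S \<Longrightarrow> y \<in> J \<Longrightarrow> x o\<^sub>L y \<in> J"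
    and ideal_right: "x \<in> J \<Longrightarrow> y \<in> S \<Longrightarrow> x o\<^sub>L y \<in> J"
begin

lemma ideal_operator_ring: "ideal J (operator_ring S)"
proof (rule idealI[OF ring_operator_ring])
  interpret R: ring "operator_ring S" by (rule ring_operator_ring)
  have neg: "- x \<in> J" if "x \<in> J" for x using ideal_diff[OF ideal_zero that] by simp
  have add: "x + y \<in> J" if "x \<in> J" "y \<in> J" for x y
    using ideal_diff[OF that(1) neg[OF that(2)]] by simp
  have inv: "inv\<^bsub>add_monoid (operator_ring S)\<^esub> x = - x" if "x \<in> J" for x
  proof -
    have "\<ominus>\<^bsub>operator_ring S\<^esub> x = - x"
      by (rule R.minus_equality) (use that ideal_subset uminus in \<open>auto simp: operator_ring_def\<close>)
    then show ?thesis by (simp add: a_inv_def)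
  qed
  show "subgroup J (add_monoid (operator_ring S))"
    by (rule subgroup.intro)
      (use ideal_subset ideal_zero neg add inv in \<open>auto simp: operator_ring_def\<close>)
qed (auto simp: operator_ring_def intro: ideal_left ideal_right)

lemma quotient_spectrum_eq:
  assumes T: "T \<in> S"
  shows "quotient_spectrum S J T =
    {c. \<not> (\<exists>y\<in>S. ((T - scalar_op c) o\<^sub>L y) - id_blinfun \<in> J \<and> (y o\<^sub>L (T - scalar_op c)) - id_blinfun \<in> J)}"
proof -
  let ?R = "operator_ring S"
  interpret I: ideal J ?R by (rule ideal_operator_ring)
  have carrier: "carrier ?R = S" and mult: "\<And>x y. x \<otimes>\<^bsub>?R\<^esub> y = x o\<^sub>L y" and one': "\<one>\<^bsub>?R\<^esub> = id_blinfun"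
    by (simp_all add: operator_ring_def)
  have Tc: "T - scalar_op c \<in> S" for c using T scalar by (rule diff)
  have "(J +>\<^bsub>?R\<^esub> T) \<ominus>\<^bsub>?R Quot J\<^esub> (J +>\<^bsub>?R\<^esub> scalar_op c) \<in> Units (?R Quot J) \<longleftrightarrow>
      (\<exists>y\<in>S. ((T - scalar_op c) o\<^sub>L y) - id_blinfun \<in> J \<and> (y o\<^sub>L (T - scalar_op c)) - id_blinfun \<in> J)" for c
  proof -
    have "(J +>\<^bsub>?R\<^esub> T) \<ominus>\<^bsub>?R Quot J\<^esub> (J +>\<^bsub>?R\<^esub> scalar_op c) = J +>\<^bsub>?R\<^esub> (T - scalar_op c)"
      using I.minus_Quot[of T "scalar_op c"] T scalar by (simp add: carrier minus_operator_ring)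
    moreover have "x \<ominus>\<^bsub>?R\<^esub> id_blinfun = x - id_blinfun" if "x \<in> S" for x
      using that one by (rule minus_operator_ring)
    ultimately show ?thesis
      using I.Units_Quot_iff[of "T - scalar_op c"] Tc[of c] compose
      by (simp add: carrier mult one' cong: bex_cong)
  qed
  then show ?thesis
    by (simp add: quotient_spectrum_def Let_def algebra_spectrum_def)
qed

lemma quotient_spectrum_add_ideal:
  assumes T: "T \<in> S" and V: "V \<in> J"
  shows "quotient_spectrum S J (T + V) = quotient_spectrum S J T"
proof -
  interpret I: ideal J "operator_ring S" by (rule ideal_operator_ring)
  have TV: "T + V \<in> S" using T V ideal_subset add by blast
  then have "(T + V) \<ominus>\<^bsub>operator_ring S\<^esub> T \<in> J"
    using T V by (simp add: minus_operator_ring)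
  then have "J +>\<^bsub>operator_ring S\<^esub> (T + V) = J +>\<^bsub>operator_ring S\<^esub> T"
    using I.quotient_eq_iff_same_a_r_cos[OF ideal_operator_ring, of "T + V" T] T TV
    by (simp add: operator_ring_def)
  then show ?thesis by (simp add: quotient_spectrum_def)
qed

end
section \<open>The two strip ideals of the plane\<close>

lemma ideal1_eq: "ideal1 = strip_ideal fst"
proof -
  have "proj1 n = strip fst n" for n
    unfolding proj1_def strip_def by (rule arg_cong[where f = mult_op]) (auto simp: fun_eq_iff abs_le_iff)
  then show ?thesis by (simp only: ideal1_def closure_strip_ideal)
qed

lemma ideal2_eq: "ideal2 = strip_ideal snd"
proof -
  have "proj2 n = strip snd n" for n
    unfolding proj2_def strip_def by (rule arg_cong[where f = mult_op]) (auto simp: fun_eq_iff abs_le_iff)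
  then show ?thesis by (simp only: ideal2_def closure_strip_ideal)
qed

lemma finite_box: "finite {x :: plane. \<bar>fst x\<bar> \<le> int n \<and> \<bar>snd x\<bar> \<le> int n}"
  by (rule finite_subset[of _ "{- int n..int n} \<times> {- int n..int n}"]) auto

lemma strip_ideals_product_compact:
  assumes "S \<in> strip_ideal fst" "T \<in> strip_ideal snd"
  shows "S o\<^sub>L T \<in> compact_operators" "T o\<^sub>L S \<in> compact_operators"
proof -
  show "S o\<^sub>L T \<in> compact_operators"
    by (rule strip_ideal_product_compact[OF finite_box assms])
  show "T o\<^sub>L S \<in> compact_operators"
    by (rule strip_ideal_product_compact[OF _ assms(2,1)])
      (rule finite_subset[OF _ finite_box], auto)
qed

lemma multiplier_algebraI:
  assumes "T \<in> bounded_operators"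
    and "\<And>S. S \<in> strip_ideal fst \<Longrightarrow> T o\<^sub>L S \<in> strip_ideal fst"
    and "\<And>S. S \<in> strip_ideal fst \<Longrightarrow> S o\<^sub>L T \<in> strip_ideal fst"
    and "\<And>S. S \<in> strip_ideal snd \<Longrightarrow> T o\<^sub>L S \<in> strip_ideal snd"
    and "\<And>S. S \<in> strip_ideal snd \<Longrightarrow> S o\<^sub>L T \<in> strip_ideal snd"
  shows "T \<in> multiplier_algebra"
  using assms unfolding multiplier_algebra_def ideal1_eq ideal2_eq by blast

lemma multiplier_algebraD:
  assumes "T \<in> multiplier_algebra"
  shows "T \<in> bounded_operators"
    and "S \<in> strip_ideal fst \<Longrightarrow> T o\<^sub>L S \<in> strip_ideal fst"
    and "S \<in> strip_ideal fst \<Longrightarrow> S o\<^sub>L T \<in> strip_ideal fst"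
    and "S \<in> strip_ideal snd \<Longrightarrow> T o\<^sub>L S \<in> strip_ideal snd"
    and "S \<in> strip_ideal snd \<Longrightarrow> S o\<^sub>L T \<in> strip_ideal snd"
  using assms unfolding multiplier_algebra_def ideal1_eq ideal2_eq by blast+

lemma strip_multipliers_in_multiplier_algebra:
  assumes "T \<in> strip_multiplier fst" "T \<in> strip_multiplier snd"
  shows "T \<in> multiplier_algebra"
  using assms
  by (intro multiplier_algebraI strip_multiplier_compose) (auto simp: strip_multiplier_def)

text \<open>
  Each strip ideal must also multiply the other one into itself. It does, because the mixed products are
  compact and compact operators lie in both ideals.
\<close>

lemma strip_ideal_subset_multiplier_algebra:
  "strip_ideal fst \<subseteq> multiplier_algebra" "strip_ideal snd \<subseteq> multiplier_algebra"
  by (auto intro!: multiplier_algebraI intro: strip_ideal_compose strip_ideal_subset_bounded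
      compact_in_strip_ideal strip_ideals_product_compact)

text \<open>
  This class contains \<open>A\<close>, \<open>H\<close> and all intermediate operators of the theorem, is stable under
  subtraction of scalars and has the property that inverses modulo compact operators are multipliers.
\<close>

definition slowly_commuting_plane :: "plane operator set" where
  "slowly_commuting_plane = bounded_operators \<inter> slowly_commuting fst \<inter> slowly_commuting snd"

lemma slowly_commuting_plane_multiplier:
  "T \<in> slowly_commuting_plane \<Longrightarrow> T \<in> multiplier_algebra"
  by (intro strip_multipliers_in_multiplier_algebra slowly_commuting_strip_multiplier)
    (auto simp: slowly_commuting_plane_def)

lemma slowly_commuting_plane_add:
  "S \<in> slowly_commuting_plane \<Longrightarrow> T \<in> slowly_commuting_plane \<Longrightarrow> S + T \<in> slowly_commuting_plane"
  by (simp add: slowly_commuting_plane_def slowly_commuting_add bounded_operators_add)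

lemma slowly_commuting_plane_mult_op:
  "bounded (range V) \<Longrightarrow> mult_op V \<in> slowly_commuting_plane"
  by (simp add: slowly_commuting_plane_def slowly_commuting_mult_op bounded_operators_mult_op)

lemma slowly_commuting_plane_shift_sum:
  fixes a :: "nat \<Rightarrow> plane \<Rightarrow> complex"
  assumes "\<And>r. r \<in> {1..m} \<Longrightarrow> bounded (range (a r))"
    and A: "\<And>f x. coord (blinfun_apply A f) x = (\<Sum>r = 1..m. a r x * coord f (x + b r))"
  shows "A \<in> slowly_commuting_plane"
proof -
  have summand: "mult_op (a r) o\<^sub>L translation (b r) \<in> slowly_commuting_plane" if "r \<in> {1..m}" for r
    using assms(1)[OF that]
    by (simp add: slowly_commuting_plane_def bounded_operators_compose bounded_operators_mult_op
        bounded_operators_translation slowly_commuting_compose slowly_commuting_mult_op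
        slowly_commuting_translation)
  have "A = (\<Sum>r = 1..m. mult_op (a r) o\<^sub>L translation (b r))"
    by (intro blinfun_eqI ell2_eqI)
      (simp add: A blinfun.sum_left coord_sum coord_mult_op[OF assms(1)] coord_translation)
  moreover have "(\<Sum>r\<in>I. mult_op (a r) o\<^sub>L translation (b r)) \<in> slowly_commuting_plane"
    if "finite I" "I \<subseteq> {1..m}" for I
    using that
  proof (induction I rule: finite_induct)
    case empty
    show ?case by (simp add: slowly_commuting_plane_def bounded_operators_zero slowly_commuting_zero)
  next
    case (insert r I)
    then show ?case by (simp add: slowly_commuting_plane_add summand)
  qed
  ultimately show ?thesis by simp
qed

text \<open>
  With error zero this also says that the exact inverse, if it exists, is a multiplier.
\<close>

lemma parametrix_in_multiplier_algebra:
  assumes "x \<in> slowly_commuting_plane" "y \<in> bounded_operators"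
    and "(x o\<^sub>L y) - id_blinfun \<in> compact_operators" "(y o\<^sub>L x) - id_blinfun \<in> compact_operators"
  shows "y \<in> multiplier_algebra"
  using assms
  by (intro strip_multipliers_in_multiplier_algebra parametrix_strip_multiplier[of x])
    (auto simp: slowly_commuting_plane_def)

lemma slowly_commuting_plane_minus_scalar:
  assumes "T \<in> slowly_commuting_plane" shows "T - scalar_op c \<in> slowly_commuting_plane"
proof -
  have eq: "T - scalar_op c = T + mult_op (\<lambda>_. - c)"
    by (intro blinfun_eqI ell2_eqI) (simp add: blinfun.diff_left blinfun.add_left minus_ell2.rep_eq
        plus_ell2.rep_eq scalar_op_apply scaleC_ell2.rep_eq coord_mult_op)
  show ?thesis
    unfolding eq using assms by (simp add: slowly_commuting_plane_add slowly_commuting_plane_mult_op)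
qed

section \<open>The spectra\<close>

interpretation calkin: operator_ideal bounded_operators compact_operators
proof
  fix S T :: "'a operator"
  assume ST: "S \<in> compact_operators" "T \<in> compact_operators"
  have "0 - id_blinfun \<in> (bounded_operators :: 'a operator set)"
    by (intro bounded_operators_intros)
  then have "S + ((0 - id_blinfun) o\<^sub>L T) \<in> compact_operators"
    using ST by (intro compact_add compact_compose_left)
  moreover have "S + ((0 - id_blinfun) o\<^sub>L T) = S - T"
    by (rule blinfun_eqI) (simp add: blinfun.add_left blinfun.diff_left blinfun.minus_left)
  ultimately show "S - T \<in> compact_operators" by simp
qed (auto intro: bounded_operators_intros compact_subset_bounded compact_zero
    compact_compose_left compact_compose_right)

lemma operator_algebra_multiplier: "operator_algebra multiplier_algebra"
proof
  show "0 \<in> multiplier_algebra"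
    using strip_ideal_subset_multiplier_algebra(1) compact_zero compact_in_strip_ideal by blast
  show "scalar_op c \<in> multiplier_algebra" for c
    by (simp add: scalar_op_def slowly_commuting_plane_mult_op slowly_commuting_plane_multiplier)
  show "S - T \<in> multiplier_algebra" if "S \<in> multiplier_algebra" "T \<in> multiplier_algebra" for S T
    using that[THEN multiplier_algebraD(1)] that[THEN multiplier_algebraD(2)]
      that[THEN multiplier_algebraD(3)] that[THEN multiplier_algebraD(4)] that[THEN multiplier_algebraD(5)]
    by (intro multiplier_algebraI)
      (simp_all add: bounded_operators_diff compose_diff_left compose_diff_right strip_ideal_diff)
  show "S o\<^sub>L T \<in> multiplier_algebra" if "S \<in> multiplier_algebra" "T \<in> multiplier_algebra" for S T
  proof (rule multiplier_algebraI)
    show "S o\<^sub>L T \<in> bounded_operators"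
      using that by (intro bounded_operators_compose multiplier_algebraD)
  next
    fix U :: "plane operator" assume U: "U \<in> strip_ideal fst"
    show "(S o\<^sub>L T) o\<^sub>L U \<in> strip_ideal fst"
      unfolding compose_assoc using that U by (intro multiplier_algebraD(2))
    show "U o\<^sub>L (S o\<^sub>L T) \<in> strip_ideal fst"
      unfolding compose_assoc[symmetric] using that U by (intro multiplier_algebraD(3))
  next
    fix U :: "plane operator" assume U: "U \<in> strip_ideal snd"
    show "(S o\<^sub>L T) o\<^sub>L U \<in> strip_ideal snd"
      unfolding compose_assoc using that U by (intro multiplier_algebraD(4))
    show "U o\<^sub>L (S o\<^sub>L T) \<in> strip_ideal snd"
      unfolding compose_assoc[symmetric] using that U by (intro multiplier_algebraD(5))
  qed
qed

interpretation strip1: operator_ideal multiplier_algebra "strip_ideal fst"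
proof (intro operator_ideal.intro operator_algebra_multiplier operator_ideal_axioms.intro)
  show "0 \<in> strip_ideal fst" using compact_zero by (rule compact_in_strip_ideal)
qed (rule strip_ideal_subset_multiplier_algebra, (rule strip_ideal_diff multiplier_algebraD; assumption)+)

interpretation strip2: operator_ideal multiplier_algebra "strip_ideal snd"
proof (intro operator_ideal.intro operator_algebra_multiplier operator_ideal_axioms.intro)
  show "0 \<in> strip_ideal snd" using compact_zero by (rule compact_in_strip_ideal)
qed (rule strip_ideal_subset_multiplier_algebra, (rule strip_ideal_diff multiplier_algebraD; assumption)+)

text \<open>
  An inverse modulo the compact operators is an inverse modulo both strip ideals, because it lies in the
  multiplier algebra. Conversely, inverses \<open>y\<close> and \<open>z\<close> modulo the two ideals combine to
  \<open>y + z - y x z\<close>, whose errors are products of an element of the first and an element of the second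
  ideal.
\<close>

lemma essential_spectrum_eq_Un:
  assumes T: "T \<in> slowly_commuting_plane"
  shows "essential_spectrum T = spectrum1 T \<union> spectrum2 T"
proof (rule Set.set_eqI)
  fix c
  define x where "x = T - scalar_op c"
  have x: "x \<in> slowly_commuting_plane"
    unfolding x_def using T by (rule slowly_commuting_plane_minus_scalar)
  have xM: "x \<in> multiplier_algebra" using x by (rule slowly_commuting_plane_multiplier)
  define inv_mod where "inv_mod S J \<longleftrightarrow>
    (\<exists>y\<in>S. (x o\<^sub>L y) - id_blinfun \<in> J \<and> (y o\<^sub>L x) - id_blinfun \<in> J)" for S J :: "plane operator set"
  have TM: "T \<in> multiplier_algebra" using T by (rule slowly_commuting_plane_multiplier)
  have TB: "T \<in> bounded_operators" using TM by (rule multiplier_algebraD)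
  have "c \<in> essential_spectrum T \<longleftrightarrow> \<not> inv_mod bounded_operators compact_operators"
    by (simp add: essential_spectrum_def calkin.quotient_spectrum_eq[OF TB] inv_mod_def x_def)
  moreover have "c \<in> spectrum1 T \<longleftrightarrow> \<not> inv_mod multiplier_algebra (strip_ideal fst)"
    by (simp add: spectrum1_def ideal1_eq strip1.quotient_spectrum_eq[OF TM] inv_mod_def x_def)
  moreover have "c \<in> spectrum2 T \<longleftrightarrow> \<not> inv_mod multiplier_algebra (strip_ideal snd)"
    by (simp add: spectrum2_def ideal2_eq strip2.quotient_spectrum_eq[OF TM] inv_mod_def x_def)
  moreover have "inv_mod multiplier_algebra (strip_ideal fst) \<and> inv_mod multiplier_algebra (strip_ideal snd)"
    if fredholm: "inv_mod bounded_operators compact_operators"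
  proof -
    obtain y where y: "y \<in> bounded_operators" "(x o\<^sub>L y) - id_blinfun \<in> compact_operators"
      "(y o\<^sub>L x) - id_blinfun \<in> compact_operators"
      using fredholm unfolding inv_mod_def by blast
    then have "y \<in> multiplier_algebra" by (rule parametrix_in_multiplier_algebra[OF x])
    then show ?thesis
      using y(2,3) compact_in_strip_ideal unfolding inv_mod_def by blast
  qed
  moreover have "inv_mod bounded_operators compact_operators"
    if inv1: "inv_mod multiplier_algebra (strip_ideal fst)" and inv2: "inv_mod multiplier_algebra (strip_ideal snd)"
  proof -
    obtain y where y: "y \<in> multiplier_algebra" "(x o\<^sub>L y) - id_blinfun \<in> strip_ideal fst"
      "(y o\<^sub>L x) - id_blinfun \<in> strip_ideal fst"
      using inv1 unfolding inv_mod_def by blast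
    obtain z where z: "z \<in> multiplier_algebra" "(x o\<^sub>L z) - id_blinfun \<in> strip_ideal snd"
      "(z o\<^sub>L x) - id_blinfun \<in> strip_ideal snd"
      using inv2 unfolding inv_mod_def by blast
    define w where "w = y + z - (y o\<^sub>L (x o\<^sub>L z))"
    have "w \<in> multiplier_algebra"
      unfolding w_def by (intro strip1.diff strip1.add strip1.compose xM y(1) z(1))
    then have "w \<in> bounded_operators" by (rule multiplier_algebraD)
    have neg: "0 - ((S - id_blinfun) o\<^sub>L (S' - id_blinfun)) \<in> compact_operators"
      if "S - id_blinfun \<in> strip_ideal fst" "S' - id_blinfun \<in> strip_ideal snd" for S S' :: "plane operator"
      using that by (intro calkin.ideal_diff compact_zero strip_ideals_product_compact)
    have "(x o\<^sub>L w) - id_blinfun = 0 - (((x o\<^sub>L y) - id_blinfun) o\<^sub>L ((x o\<^sub>L z) - id_blinfun))"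
      by (simp add: w_def compose_simps)
    moreover have "(w o\<^sub>L x) - id_blinfun = 0 - (((y o\<^sub>L x) - id_blinfun) o\<^sub>L ((z o\<^sub>L x) - id_blinfun))"
      by (simp add: w_def compose_simps)
    ultimately show ?thesis
      using neg[OF y(2) z(2)] neg[OF y(3) z(3)] \<open>w \<in> bounded_operators\<close>
      unfolding inv_mod_def by metis
  qed
  ultimately show "c \<in> essential_spectrum T \<longleftrightarrow> c \<in> spectrum1 T \<union> spectrum2 T"
    by blast
qed

text \<open>
  An exact inverse is a multiplier and hence an inverse modulo the ideal; conversely, invariance under the
  translation upgrades an inverse modulo the ideal to the existence of an exact one.
\<close>

lemma quotient_spectrum_eq_spectrum:
  assumes T: "T \<in> slowly_commuting_plane"
    and ideal: "operator_ideal multiplier_algebra (strip_ideal h)"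
    and add: "\<And>x y :: plane. h (x + y) = h x + h y" and e: "1 \<le> h e"
    and comm: "T o\<^sub>L translation e = translation e o\<^sub>L T"
  shows "quotient_spectrum multiplier_algebra (strip_ideal h) T = spectrum T"
proof -
  interpret operator_ideal multiplier_algebra "strip_ideal h" by (rule ideal)
  have TM: "T \<in> multiplier_algebra" using T by (rule slowly_commuting_plane_multiplier)
  have TB: "T \<in> bounded_operators" using TM by (rule multiplier_algebraD)
  have "(\<exists>y\<in>multiplier_algebra. ((T - scalar_op c) o\<^sub>L y) - id_blinfun \<in> strip_ideal h
        \<and> (y o\<^sub>L (T - scalar_op c)) - id_blinfun \<in> strip_ideal h) \<longleftrightarrow>
      (\<exists>z\<in>bounded_operators. (T - scalar_op c) o\<^sub>L z = id_blinfun \<and> z o\<^sub>L (T - scalar_op c) = id_blinfun)"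
    (is "?L \<longleftrightarrow> ?R") for c
  proof
    assume ?L
    have "scalar_op c o\<^sub>L translation e = translation e o\<^sub>L scalar_op c"
      by (intro blinfun_eqI ell2_eqI) (simp add: scalar_op_apply scaleC_ell2.rep_eq coord_translation)
    then have "(T - scalar_op c) o\<^sub>L translation e = translation e o\<^sub>L (T - scalar_op c)"
      by (simp add: compose_diff_left compose_diff_right comm)
    moreover have "T - scalar_op c \<in> bounded_operators"
      using TB by (intro bounded_operators_intros)
    ultimately show ?R
      using \<open>?L\<close> invertible_if_invertible_modulo_strip[OF add e] by (auto simp: strip_ideal_def)
  next
    assume ?R
    then obtain z where z: "z \<in> bounded_operators" "(T - scalar_op c) o\<^sub>L z = id_blinfun"
      "z o\<^sub>L (T - scalar_op c) = id_blinfun" by blast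
    then have "z \<in> multiplier_algebra"
      by (intro parametrix_in_multiplier_algebra[OF slowly_commuting_plane_minus_scalar[OF T, of c]])
        (simp_all add: compact_zero)
    then show ?L using z(2,3) ideal_zero by force
  qed
  then show ?thesis
    by (simp add: quotient_spectrum_eq[OF TM] spectrum_def calkin.spectrum_operator_ring[OF TB])
qed

text \<open>
  The multiples of a step along one axis, in the iterated form of \<open>commute_translation_multiple\<close>; they
  give two periodic operators a common period.
\<close>

lemma multiple_of_step:
  "((+) (k, 0 :: int) ^^ n) 0 = (int n * k, 0)" "((+) (0 :: int, k) ^^ n) 0 = (0, int n * k)"
  by (induction n) (auto simp: algebra_simps zero_prod_def)

lemma periodic1_add:
  assumes "periodic1 S" "periodic1 T" shows "periodic1 (S + T)"
proof -
  obtain k l where k: "1 \<le> k" "S o\<^sub>L translation (k, 0) = translation (k, 0) o\<^sub>L S"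
    and l: "1 \<le> l" "T o\<^sub>L translation (l, 0) = translation (l, 0) o\<^sub>L T"
    using assms by (auto simp: periodic1_def)
  have "S o\<^sub>L translation (k * l, 0) = translation (k * l, 0) o\<^sub>L S"
    using commute_translation_multiple[OF k(2), of "nat l"] l(1) by (simp add: multiple_of_step mult.commute)
  moreover have "T o\<^sub>L translation (k * l, 0) = translation (k * l, 0) o\<^sub>L T"
    using commute_translation_multiple[OF l(2), of "nat k"] k(1) by (simp add: multiple_of_step)
  moreover have "1 \<le> k * l" using mult_mono[of 1 k 1 l] k(1) l(1) by simp
  ultimately show ?thesis
    unfolding periodic1_def by (auto simp: compose_add_left compose_add_right)
qed

lemma periodic2_add:
  assumes "periodic2 S" "periodic2 T" shows "periodic2 (S + T)"
proof -
  obtain k l where k: "1 \<le> k" "S o\<^sub>L translation (0, k) = translation (0, k) o\<^sub>L S"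
    and l: "1 \<le> l" "T o\<^sub>L translation (0, l) = translation (0, l) o\<^sub>L T"
    using assms by (auto simp: periodic2_def)
  have "S o\<^sub>L translation (0, k * l) = translation (0, k * l) o\<^sub>L S"
    using commute_translation_multiple[OF k(2), of "nat l"] l(1) by (simp add: multiple_of_step mult.commute)
  moreover have "T o\<^sub>L translation (0, k * l) = translation (0, k * l) o\<^sub>L T"
    using commute_translation_multiple[OF l(2), of "nat k"] k(1) by (simp add: multiple_of_step)
  moreover have "1 \<le> k * l" using mult_mono[of 1 k 1 l] k(1) l(1) by simp
  ultimately show ?thesis
    unfolding periodic2_def by (auto simp: compose_add_left compose_add_right)
qed

lemma spectrum1_eq_spectrum:
  assumes "T \<in> slowly_commuting_plane" "periodic1 T"
  shows "spectrum1 T = spectrum T"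
proof -
  obtain k where k: "1 \<le> k" "T o\<^sub>L translation (k, 0) = translation (k, 0) o\<^sub>L T"
    using assms(2) by (auto simp: periodic1_def)
  show ?thesis
    unfolding spectrum1_def ideal1_eq
    by (rule quotient_spectrum_eq_spectrum[OF assms(1) strip1.operator_ideal_axioms _ _ k(2)])
      (simp_all add: k(1))
qed

lemma spectrum2_eq_spectrum:
  assumes "T \<in> slowly_commuting_plane" "periodic2 T"
  shows "spectrum2 T = spectrum T"
proof -
  obtain k where k: "1 \<le> k" "T o\<^sub>L translation (0, k) = translation (0, k) o\<^sub>L T"
    using assms(2) by (auto simp: periodic2_def)
  show ?thesis
    unfolding spectrum2_def ideal2_eq
    by (rule quotient_spectrum_eq_spectrum[OF assms(1) strip2.operator_ideal_axioms _ _ k(2)])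
      (simp_all add: k(1))
qed

theorem theorem11:
  fixes A H :: "plane operator"
    and m :: nat and a :: "nat \<Rightarrow> plane \<Rightarrow> complex" and b :: "nat \<Rightarrow> plane"
    and V1 V2 :: "plane \<Rightarrow> complex" and a1 a2 :: int
  assumes "\<And>r. r \<in> {1..m} \<Longrightarrow> bounded (range (a r))"
    and "\<And>f x. coord (blinfun_apply A f) x = (\<Sum>r = 1..m. a r x * coord f (x + b r))"
    and "periodic1 A" and "periodic2 A"
    and "bounded (range V1)" and "bounded (range V2)"
    and "{x. V1 x \<noteq> 0} \<subseteq> UNIV \<times> {- a2..a2}"
    and "{x. V2 x \<noteq> 0} \<subseteq> {- a1..a1} \<times> UNIV"
    and "H = A + mult_op V1 + mult_op V2"
  shows "H \<in> multiplier_algebra \<and>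
    essential_spectrum H = spectrum1 (A + mult_op V1) \<union> spectrum2 (A + mult_op V2) \<and>
    (periodic1 (mult_op V1) \<and> periodic2 (mult_op V2) \<longrightarrow>
      essential_spectrum H = spectrum (A + mult_op V1) \<union> spectrum (A + mult_op V2))"
proof -
  have A: "A \<in> slowly_commuting_plane"
    by (rule slowly_commuting_plane_shift_sum[OF assms(1,2)])
  have AV1: "A + mult_op V1 \<in> slowly_commuting_plane" and AV2: "A + mult_op V2 \<in> slowly_commuting_plane"
    using A assms(5,6) by (auto intro: slowly_commuting_plane_add slowly_commuting_plane_mult_op)
  have H: "H \<in> slowly_commuting_plane"
    using AV1 assms(6,9) by (auto intro: slowly_commuting_plane_add slowly_commuting_plane_mult_op)
  have "\<bar>snd x\<bar> \<le> int (nat a2)" if "V1 x \<noteq> 0" for x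
    using subsetD[OF assms(7), of x] that by auto
  then have V1: "mult_op V1 \<in> strip_ideal snd"
    by (rule mult_op_in_strip_ideal[OF assms(5)])
  have "\<bar>fst x\<bar> \<le> int (nat a1)" if "V2 x \<noteq> 0" for x
    using subsetD[OF assms(8), of x] that by auto
  then have V2: "mult_op V2 \<in> strip_ideal fst"
    by (rule mult_op_in_strip_ideal[OF assms(6)])
  have "spectrum1 H = spectrum1 (A + mult_op V1)"
    unfolding assms(9) spectrum1_def ideal1_eq
    by (rule strip1.quotient_spectrum_add_ideal[OF slowly_commuting_plane_multiplier[OF AV1] V2])
  moreover have "spectrum2 H = spectrum2 (A + mult_op V2)"
    using strip2.quotient_spectrum_add_ideal[OF slowly_commuting_plane_multiplier[OF AV2] V1]
    unfolding assms(9) spectrum2_def ideal2_eq by (simp add: ac_simps)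
  ultimately have ess: "essential_spectrum H = spectrum1 (A + mult_op V1) \<union> spectrum2 (A + mult_op V2)"
    by (simp add: essential_spectrum_eq_Un[OF H])
  moreover have "spectrum1 (A + mult_op V1) = spectrum (A + mult_op V1)" if "periodic1 (mult_op V1)"
    using AV1 assms(3) that by (intro spectrum1_eq_spectrum periodic1_add)
  moreover have "spectrum2 (A + mult_op V2) = spectrum (A + mult_op V2)" if "periodic2 (mult_op V2)"
    using AV2 assms(4) that by (intro spectrum2_eq_spectrum periodic2_add)
  ultimately show ?thesis
    using slowly_commuting_plane_multiplier[OF H] by auto
qed

end
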